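(* For every real $\lambda\ge \frac35$ one has $$ \dim S_s(\lambda) = \max\left\{\frac{2-2\lambda}{1+\lambda}, \frac{2}{3(1+\lambda)}\right\}. $$
   Context: $\dim$ denotes Hausdorff dimension. For coprime $(u,v)\in\mathbb{Z}^2$, let $L_{P_{u,v}}\subset\mathbb{R}^4$ be the two-dimensional linear subspace attached to the polynomial $P_{u,v}(x)=(vx-u)^2$, namely the set of $(x_0,x_1,x_2,x_3)$ with $$u^2x_0-2uvx_1+v^2x_2=0,\qquad u^2x_1-2uvx_2+v^2x_3=0.$$ A point $\mathbf p=(p_0,p_1,p_2,p_3)\in\mathbb{Z}^4$ is called special if $\mathbf p\in L_{P_{u,v}}$ for some coprime $(u,v)\in\mathbb{Z}^2$. $S_s(\lambda)$ is the set of all $\xi\in\mathbb{R}$ such that $$\max_{1\le i\le3}|p_0\xi^i-p_i|<p_0^{-\lambda}$$ for infinitely many special $\mathbf p=(p_0,p_1,p_2,p_3)\in\mathbb{Z}_{>0}\times\mathbb{Z}^3$. *)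

theory Defs
  imports "HOL-Analysis.Analysis"
begin

text \<open>
  The \<open>s\<close>-dimensional size of a bounded set, with the usual convention that the
  zeroth power of the diameter is 1 for every nonempty set, singletons included
  (whereas \<open>0 powr 0 = 0\<close>).
\<close>

definition gauge_power :: "real \<Rightarrow> 'a::metric_space set \<Rightarrow> ennreal" where
  "gauge_power s U =
     (if U = {} then 0 else if s = 0 then 1 else ennreal (diameter U powr s))"

text \<open>
  Countable covers are indexed by \<open>nat\<close>; empty members account for finite covers.
  Boundedness is required explicitly because \<open>diameter\<close> is meaningful only for
  bounded sets.
\<close>

definition delta_covers :: "real \<Rightarrow> 'a::metric_space set \<Rightarrow> (nat \<Rightarrow> 'a set) set" where
  "delta_covers \<delta> A =
     {U. A \<subseteq> (\<Union>i. U i) \<and> (\<forall>i. bounded (U i) \<and> diameter (U i) \<le> \<delta>)}"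

definition hausdorff_premeasure :: "real \<Rightarrow> real \<Rightarrow> 'a::metric_space set \<Rightarrow> ennreal" where
  "hausdorff_premeasure s \<delta> A = (INF U \<in> delta_covers \<delta> A. \<Sum>i. gauge_power s (U i))"

definition hausdorff_measure :: "real \<Rightarrow> 'a::metric_space set \<Rightarrow> ennreal" where
  "hausdorff_measure s A = (SUP \<delta> \<in> {0<..}. hausdorff_premeasure s \<delta> A)"

definition hausdorff_dim :: "'a::metric_space set \<Rightarrow> ereal" where
  "hausdorff_dim A = Inf {ereal s | s. 0 \<le> s \<and> hausdorff_measure s A = 0}"

text \<open>The subspace attached to the polynomial \<open>(v x - u)\<^sup>2 = u\<^sup>2 - 2 u v x + v\<^sup>2 x\<^sup>2\<close>.\<close>

definition L_square :: "int \<Rightarrow> int \<Rightarrow> (real \<times> real \<times> real \<times> real) set" where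
  "L_square u v = {(x0, x1, x2, x3).
     (of_int u)\<^sup>2 * x0 - 2 * of_int u * of_int v * x1 + (of_int v)\<^sup>2 * x2 = 0 \<and>
     (of_int u)\<^sup>2 * x1 - 2 * of_int u * of_int v * x2 + (of_int v)\<^sup>2 * x3 = 0}"

definition special :: "int \<times> int \<times> int \<times> int \<Rightarrow> bool" where
  "special = (\<lambda>(p0, p1, p2, p3). \<exists>u v. coprime u v \<and>
     (real_of_int p0, real_of_int p1, real_of_int p2, real_of_int p3) \<in> L_square u v)"

definition S_s :: "real \<Rightarrow> real set" where
  "S_s lam = {\<xi>. infinite {(p0, p1, p2, p3). special (p0, p1, p2, p3) \<and> 0 < p0 \<and>
     Max {abs (of_int p0 * \<xi> - of_int p1), abs (of_int p0 * \<xi>^2 - of_int p2),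
          abs (of_int p0 * \<xi>^3 - of_int p3)} < of_int p0 powr (- lam)}}"

end

theory Submission
  imports Defs "HOL-Real_Asymp.Real_Asymp"
begin

text \<open>
  Write \<open>\<gamma>(x) = (1, x, x\<^sup>2, x\<^sup>3)\<close> and \<open>r = u/v\<close>. The plane attached to \<open>(v x - u)\<^sup>2\<close> is spanned by
  \<open>\<gamma>(r)\<close> and \<open>\<gamma>'(r)\<close>, so after division by \<open>p\<^sub>0\<close> a special point is a point
  \<open>\<gamma>(r) + \<eta> \<gamma>'(r)\<close> on a tangent line of the cubic curve, with \<open>\<eta> = p\<^sub>1/p\<^sub>0 - r\<close>. It lies within
  \<open>p\<^sub>0 powr (-1-\<lambda>)\<close> of \<open>\<gamma>(\<xi>)\<close> exactly (up to constants) when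
  \<open>\<bar>\<xi> - r - \<eta>\<bar>\<close> and \<open>(\<xi> - r)\<^sup>2\<close> are both at most \<open>p\<^sub>0 powr (-1-\<lambda>)\<close>. Integrality forces \<open>v\<close> to divide
  \<open>p\<^sub>1\<close> and \<open>v\<^sup>2\<close> to divide \<open>p\<^sub>0\<close>, which leaves two kinds of special points.

  If \<open>\<eta> = 0\<close>, then \<open>v\<^sup>3\<close> divides \<open>p\<^sub>0\<close> and \<open>\<xi>\<close> satisfies \<open>\<bar>\<xi> - u/v\<bar> < v powr (-3(1+\<lambda>))\<close>; conversely
  \<open>(v\<^sup>3, v\<^sup>2 u, v u\<^sup>2, u\<^sup>3)\<close> is special. This is a classical problem of approximation by rationals
  and contributes the dimension \<open>2/(3(1+\<lambda>))\<close>.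

  If \<open>\<eta> \<noteq> 0\<close>, then \<open>\<bar>\<eta>\<bar> \<ge> v/p\<^sub>0\<close> while \<open>\<bar>\<eta>\<bar>\<close> is at most a constant times \<open>p\<^sub>0 powr (-(1+\<lambda>)/2)\<close>. Hence
  \<open>p\<^sub>0\<close> is at least about \<open>v powr (2/(1-\<lambda>))\<close>, so that \<open>\<xi>\<close> lies within a constant times
  \<open>v powr (-(1+\<lambda>)/(1-\<lambda>))\<close> of \<open>u/v\<close>, a condition of dimension \<open>(2-2\<lambda>)/(1+\<lambda>)\<close>; for \<open>\<lambda> \<ge> 1\<close> only
  boundedly many \<open>v\<close> occur, so such points approximate no irrational number infinitely often.

  The upper bound is the covering of \<open>S_s \<lambda>\<close> by these neighbourhoods of rationals
  (\<open>S_s_approximations\<close>, \<open>null_well_approximable\<close>).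

  For the lower bound the points with \<open>\<eta> \<noteq> 0\<close> need care, because \<open>S_s \<lambda>\<close> does not contain the
  whole neighbourhood of \<open>u/v\<close>: taking \<open>\<eta> = 1/(v q)\<close> with \<open>v dvd u q + 3\<close> and \<open>q\<close> slightly larger
  than \<open>v powr (2\<lambda>/(1-\<lambda>))\<close>, one only finds in it many far smaller intervals, starting at
  \<open>u/v + 1/(v q)\<close>. So one builds a Cantor set in which each generation passes through
  both scales. A counting argument and compactness (\<open>cantor_positive_measure\<close>) give positive \<open>s\<close>-dimensional measure provided each generation is
  spread out well enough at every intermediate scale. The spreading at the smallest scale requires
  \<open>s < 1/2\<close>, and \<open>\<lambda> \<ge> 3/5\<close> says precisely that \<open>(2-2\<lambda>)/(1+\<lambda>) \<le> 1/2\<close>. The approximations with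
  \<open>\<eta> = 0\<close> fit the same scheme with one point near each fraction. At the
  scale of the fractions \<open>u/v\<close> themselves one needs that an interval of length \<open>l\<close> contains at
  least a constant times \<open>l V\<^sup>2\<close> reduced fractions with denominator of size about \<open>V\<close>
  (\<open>eventually_many_reduced_pairs\<close>); these are automatically \<open>1/V\<^sup>2\<close> apart.
\<close>

section \<open>Null sets and Hausdorff dimension\<close>

lemma premeasure_le_sum:
  assumes "A \<subseteq> (\<Union>i. U i)" "\<And>i. bounded (U i)" "\<And>i. diameter (U i) \<le> \<delta>"
  shows "hausdorff_premeasure s \<delta> A \<le> (\<Sum>i. gauge_power s (U i))"
  unfolding hausdorff_premeasure_def
  by (rule INF_lower) (use assms in \<open>auto simp: delta_covers_def\<close>)

lemma premeasure_mono:
  assumes "A \<subseteq> B"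
  shows "hausdorff_premeasure s \<delta> A \<le> hausdorff_premeasure s \<delta> B"
  unfolding hausdorff_premeasure_def
  by (rule INF_superset_mono) (use assms in \<open>auto simp: delta_covers_def\<close>)

lemma premeasure_le_gauge:
  assumes "bounded A" "diameter A \<le> \<delta>" "0 \<le> \<delta>"
  shows "hausdorff_premeasure s \<delta> A \<le> gauge_power s A"
proof -
  define U where "U = (\<lambda>i::nat. if i = 0 then A else {})"
  have "hausdorff_premeasure s \<delta> A \<le> (\<Sum>i. gauge_power s (U i))"
    by (rule premeasure_le_sum) (use assms in \<open>auto simp: U_def\<close>)
  also have "\<dots> = (\<Sum>i\<in>{0}. gauge_power s (U i))"
    by (rule suminf_finite) (auto simp: U_def gauge_power_def)
  finally show ?thesis by (simp add: U_def)
qed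

lemma premeasure_empty:
  assumes "0 \<le> \<delta>"
  shows "hausdorff_premeasure s \<delta> {} = 0"
  using premeasure_le_gauge[of "{}" \<delta> s] assms by (simp add: gauge_power_def)

text \<open>
  Covers of the single sets, with errors summing to an arbitrary \<open>e\<close>, are merged into one cover
  along the enumeration of pairs \<open>prod_decode\<close>.
\<close>

lemma premeasure_UN_le:
  fixes A :: "nat \<Rightarrow> 'a::metric_space set"
  shows "hausdorff_premeasure s \<delta> (\<Union>i. A i) \<le> (\<Sum>i. hausdorff_premeasure s \<delta> (A i))"
    (is "?L \<le> ?R")
proof (rule ennreal_le_epsilon)
  fix e :: real assume e: "0 < e" and fin: "?R < top"
  define w where "w = (\<lambda>i::nat. ennreal (e * (1/2)^Suc i))"
  have wpos: "0 < w i" for i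
    using e by (simp add: w_def)
  have fini: "hausdorff_premeasure s \<delta> (A i) < top" for i
    by (rule ennreal_suminf_lessD[OF fin])
  have "\<exists>U \<in> delta_covers \<delta> (A i).
          (\<Sum>j. gauge_power s (U j)) < hausdorff_premeasure s \<delta> (A i) + w i" for i
  proof -
    have "hausdorff_premeasure s \<delta> (A i) < hausdorff_premeasure s \<delta> (A i) + w i"
      using ennreal_add_left_cancel_less[of "hausdorff_premeasure s \<delta> (A i)" 0 "w i"]
        wpos[of i] fini[of i] by auto
    then show ?thesis
      by (subst (asm) hausdorff_premeasure_def) (simp add: INF_less_iff)
  qed
  then obtain U where U: "\<And>i. U i \<in> delta_covers \<delta> (A i)"
    and Us: "\<And>i. (\<Sum>j. gauge_power s (U i j)) < hausdorff_premeasure s \<delta> (A i) + w i"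
    by metis
  define W where "W = (\<lambda>n. case_prod U (prod_decode n))"
  have "?L \<le> (\<Sum>n. gauge_power s (W n))"
  proof (rule premeasure_le_sum)
    show "(\<Union>i. A i) \<subseteq> (\<Union>i. W i)"
    proof
      fix x assume "x \<in> (\<Union>i. A i)"
      then obtain i where "x \<in> A i" by blast
      then obtain j where "x \<in> U i j" using U[of i] by (auto simp: delta_covers_def)
      then have "x \<in> W (prod_encode (i, j))" by (simp add: W_def)
      then show "x \<in> (\<Union>i. W i)" by blast
    qed
  qed (use U in \<open>auto simp: W_def delta_covers_def split: prod.split\<close>)
  also have "\<dots> = (\<Sum>i. \<Sum>j. gauge_power s (U i j))"
    using suminf_ennreal_2dimen[of "\<lambda>i. \<Sum>j. gauge_power s (U i j)" "\<lambda>(i,j). gauge_power s (U i j)"]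
    by (simp add: W_def case_prod_beta)
  also have "\<dots> \<le> (\<Sum>i. hausdorff_premeasure s \<delta> (A i) + w i)"
    by (intro suminf_le) (auto intro: less_imp_le Us)
  also have "\<dots> = ?R + (\<Sum>i. w i)"
    by (simp add: suminf_add[symmetric])
  also have "(\<Sum>i. w i) = ennreal e"
  proof -
    have "(\<Sum>i. w i) = ennreal (e * 1)"
      unfolding w_def
      using sums_mult[OF power_half_series, of e] e by (intro suminf_ennreal_eq) auto
    then show ?thesis by simp
  qed
  finally show "?L \<le> ?R + ennreal e" .
qed

lemma hausdorff_measure_eq_0_iff:
  "hausdorff_measure s A = 0 \<longleftrightarrow> (\<forall>\<delta>>0. hausdorff_premeasure s \<delta> A = 0)"
  by (auto simp: hausdorff_measure_def SUP_eq_iff bot_ennreal[symmetric] SUP_bot_conv)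

lemma null_UN:
  fixes A :: "nat \<Rightarrow> 'a::metric_space set"
  assumes "\<And>i. hausdorff_measure s (A i) = 0"
  shows "hausdorff_measure s (\<Union>i. A i) = 0"
  unfolding hausdorff_measure_eq_0_iff
proof (intro allI impI)
  fix \<delta> :: real assume "\<delta> > 0"
  then have "\<And>i. hausdorff_premeasure s \<delta> (A i) = 0"
    using assms by (simp add: hausdorff_measure_eq_0_iff)
  then show "hausdorff_premeasure s \<delta> (\<Union>i. A i) = 0"
    using premeasure_UN_le[of s \<delta> A] by simp
qed

lemma null_mono:
  assumes "A \<subseteq> B" "hausdorff_measure s B = 0"
  shows "hausdorff_measure s A = 0"
  using premeasure_mono[OF assms(1), of s] assms(2)
  by (auto simp: hausdorff_measure_eq_0_iff) (metis le_zero_eq)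

lemma null_countable:
  fixes A :: "'a::metric_space set"
  assumes "countable A" "0 < s"
  shows "hausdorff_measure s A = 0"
proof (cases "A = {}")
  case True
  then show ?thesis by (simp add: hausdorff_measure_eq_0_iff premeasure_empty)
next
  case False
  have "hausdorff_measure s {x::'a} = 0" for x
    unfolding hausdorff_measure_eq_0_iff
  proof (intro allI impI)
    fix \<delta> :: real assume "\<delta> > 0"
    then show "hausdorff_premeasure s \<delta> {x} = 0"
      using premeasure_le_gauge[of "{x}" \<delta> s] assms(2) by (simp add: gauge_power_def)
  qed
  then have "hausdorff_measure s (\<Union>i. {from_nat_into A i}) = 0"
    by (rule null_UN)
  moreover have "(\<Union>i. {from_nat_into A i}) = A"
    using range_from_nat_into[OF False assms(1)] by auto
  ultimately show ?thesis by simp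
qed

lemma gauge_antimono:
  assumes "0 \<le> s" "s \<le> t" "0 < t" "bounded U" "diameter U \<le> 1"
  shows "gauge_power t U \<le> gauge_power s U"
proof (cases "U = {} \<or> s = 0")
  case True
  then show ?thesis
    using assms powr_le1[of t "diameter U"] diameter_ge_0[OF assms(4)]
    by (auto simp: gauge_power_def)
next
  case False
  then show ?thesis
    using assms powr_mono'[of s t "diameter U"] diameter_ge_0[OF assms(4)]
    by (auto simp: gauge_power_def intro!: ennreal_leI)
qed

lemma premeasure_antimono_scale:
  assumes "\<delta> \<le> \<delta>'"
  shows "hausdorff_premeasure s \<delta>' A \<le> hausdorff_premeasure s \<delta> A"
  unfolding hausdorff_premeasure_def
  by (rule INF_superset_mono) (use assms in \<open>auto simp: delta_covers_def intro: order_trans\<close>)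

text \<open>
  At scales at most 1 the \<open>t\<close>-th power of a diameter is bounded by its \<open>s\<close>-th power. The
  case \<open>s = 0\<close> is included, so a dimension can be tested on positive exponents alone.
\<close>

lemma null_mono_exponent:
  assumes "0 \<le> s" "s \<le> t" "0 < t" "hausdorff_measure s A = 0"
  shows "hausdorff_measure t A = 0"
  unfolding hausdorff_measure_eq_0_iff
proof (intro allI impI)
  fix \<delta> :: real assume \<delta>: "0 < \<delta>"
  have "hausdorff_premeasure t \<delta> A \<le> hausdorff_premeasure t (min \<delta> 1) A"
    by (rule premeasure_antimono_scale) simp
  also have "\<dots> \<le> hausdorff_premeasure s (min \<delta> 1) A"
    unfolding hausdorff_premeasure_def
    by (intro INF_mono' suminf_le INF_superset_mono order_refl) (auto simp: delta_covers_def intro!: gauge_antimono assms)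
  also have "\<dots> = 0" using assms(4) \<delta> by (simp add: hausdorff_measure_eq_0_iff)
  finally show "hausdorff_premeasure t \<delta> A = 0" by simp
qed

lemma hausdorff_dim_eqI:
  assumes d: "0 < d" and null: "\<And>s. d < s \<Longrightarrow> hausdorff_measure s A = 0"
    and pos: "\<And>s. 0 < s \<Longrightarrow> s < d \<Longrightarrow> hausdorff_measure s A \<noteq> 0"
  shows "hausdorff_dim A = ereal d"
  unfolding hausdorff_dim_def
proof (rule antisym)
  show "Inf {ereal s |s. 0 \<le> s \<and> hausdorff_measure s A = 0} \<le> ereal d"
  proof (rule ereal_le_epsilon2)
    fix e :: real assume "0 < e"
    then have "ereal (d + e) \<in> {ereal s |s. 0 \<le> s \<and> hausdorff_measure s A = 0}"
      using null[of "d + e"] d by auto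
    then show "Inf {ereal s |s. 0 \<le> s \<and> hausdorff_measure s A = 0} \<le> ereal d + ereal e"
      by (simp add: Inf_lower)
  qed
  show "ereal d \<le> Inf {ereal s |s. 0 \<le> s \<and> hausdorff_measure s A = 0}"
  proof (rule Inf_greatest)
    fix x assume "x \<in> {ereal s |s. 0 \<le> s \<and> hausdorff_measure s A = 0}"
    then obtain s where s: "x = ereal s" "0 \<le> s" "hausdorff_measure s A = 0" by blast
    have "d \<le> s"
    proof (rule ccontr)
      assume "\<not> d \<le> s"
      then obtain t where t: "s < t" "t < d" using dense[of s d] by auto
      then have "hausdorff_measure t A = 0" using null_mono_exponent[of s t A] s by simp
      then show False using pos[of t] t s by simp
    qed
    then show "ereal d \<le> x" by (simp add: s)
  qed
qed

section \<open>A Cantor construction of sets of positive measure\<close>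

text \<open>
  The points fall into different cells of a grid of mesh \<open>g\<close>.
\<close>

lemma card_separated_le:
  fixes S :: "real set"
  assumes "S \<subseteq> {x..x+D}" "0 < g" "0 \<le> D"
    and sep: "\<And>y z. y \<in> S \<Longrightarrow> z \<in> S \<Longrightarrow> y < z \<Longrightarrow> g \<le> z - y"
  shows "finite S" "real (card S) \<le> D / g + 1"
proof -
  define f where "f = (\<lambda>y. nat \<lfloor>(y - x) / g\<rfloor>)"
  have inj: "inj_on f S"
  proof (rule linorder_inj_onI)
    fix y z assume yz: "y < z" "y \<in> S" "z \<in> S"
    have "(y - x) / g + 1 \<le> (z - x) / g"
      using divide_right_mono[OF sep[OF yz(2,3,1)], of g] assms(2)
      by (simp add: diff_divide_distrib)
    moreover have "0 \<le> (y - x) / g" using assms(1,2) yz by auto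
    ultimately show "f y \<noteq> f z" unfolding f_def by linarith
  qed auto
  have sub: "f ` S \<subseteq> {..nat \<lfloor>D / g\<rfloor>}"
    using assms by (auto simp: f_def intro!: nat_mono floor_mono divide_right_mono)
  show fin: "finite S" using finite_imageD[OF finite_subset[OF sub] inj] by simp
  have "card S = card (f ` S)" by (simp add: card_image inj)
  also have "\<dots> \<le> card {..nat \<lfloor>D / g\<rfloor>}" by (rule card_mono[OF _ sub]) simp
  finally have "real (card S) \<le> real (nat \<lfloor>D / g\<rfloor>) + 1" by simp
  also have "real (nat \<lfloor>D / g\<rfloor>) \<le> D / g" using assms by simp
  finally show "real (card S) \<le> D / g + 1" by simp
qed

text \<open>
  \<open>Y\<close> stands for the family of intervals of length \<open>l'\<close> with left ends in \<open>Y\<close>. The last clause is the Frostman-type condition: if each subinterval has mass \<open>1 / card Y\<close>, an interval of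
  length \<open>d\<close> meets subintervals of total mass at most \<open>C (d/l) powr s\<close>, for all \<open>d\<close> between \<open>l'\<close> and \<open>l\<close>.
\<close>

definition spread :: "real \<Rightarrow> real \<Rightarrow> real \<Rightarrow> real \<Rightarrow> real \<Rightarrow> real set \<Rightarrow> bool" where
  "spread C s a l l' Y \<longleftrightarrow> finite Y \<and> (\<forall>y\<in>Y. a \<le> y \<and> y + l' \<le> a + l) \<and>
     (\<forall>y\<in>Y. \<forall>z\<in>Y. y < z \<longrightarrow> l' < z - y) \<and>
     (\<forall>x d. l' \<le> d \<and> d \<le> l \<longrightarrow>
        real (card {y\<in>Y. y \<le> x + d \<and> x \<le> y + l'}) \<le> C * real (card Y) * (d / l) powr s)"

text \<open>
  Since the length \<open>l'\<close> and the number \<open>m\<close> of children depend only on \<open>l\<close> and \<open>n\<close>, and not on the position \<open>a\<close>, all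
  intervals of one generation have the same length and the same number of children. Masses are then
  ratios of cardinalities, and no measure has to be constructed.
\<close>

lemma cantor_tree_exists:
  fixes E :: "nat \<Rightarrow> real set"
  assumes step: "\<forall>l n. 0 < l \<and> l \<le> 1 \<longrightarrow>
      (\<exists>l' m. 0 < l' \<and> l' \<le> l / 2 \<and> 1 \<le> real m * l' powr s \<and>
        (\<forall>a. 0 \<le> a \<and> a + l \<le> 1 \<longrightarrow>
          (\<exists>Y. spread C s a l l' Y \<and> card Y = m \<and> (\<forall>y\<in>Y. {y..y+l'} \<subseteq> E n))))"
  obtains l :: "nat \<Rightarrow> real" and m :: "nat \<Rightarrow> nat" and L :: "nat \<Rightarrow> real set"
    and Y :: "nat \<Rightarrow> real \<Rightarrow> real set"
  where "l 0 = 1" "\<And>k. 0 < l k" "\<And>k. l (Suc k) \<le> l k / 2" "\<And>k. 1 \<le> real (m k) * l (Suc k) powr s"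
    "L 0 = {0}" "\<And>k. L (Suc k) = (\<Union>a\<in>L k. Y k a)"
    "\<And>k a. a \<in> L k \<Longrightarrow> 0 \<le> a \<and> a + l k \<le> 1"
    "\<And>k a. a \<in> L k \<Longrightarrow> spread C s a (l k) (l (Suc k)) (Y k a)"
    "\<And>k a. a \<in> L k \<Longrightarrow> card (Y k a) = m k"
    "\<And>k a y. a \<in> L k \<Longrightarrow> y \<in> Y k a \<Longrightarrow> {y..y + l (Suc k)} \<subseteq> E k"
proof -
  define P where "P = (\<lambda>l n p. 0 < fst p \<and> fst p \<le> l / 2 \<and> 1 \<le> real (snd p) * fst p powr s \<and>
        (\<forall>a. 0 \<le> a \<and> a + l \<le> 1 \<longrightarrow> (\<exists>Y. spread C s a l (fst p) Y \<and> card Y = snd p \<and>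
           (\<forall>y\<in>Y. {y..y+fst p} \<subseteq> E n))))"
  have "P l n (SOME p. P l n p)" if "0 < l" "l \<le> 1" for l n
    by (rule someI_ex) (use step that in \<open>auto simp: P_def\<close>)
  then obtain sh :: "real \<Rightarrow> nat \<Rightarrow> real" and mm :: "real \<Rightarrow> nat \<Rightarrow> nat"
    where SP: "\<And>l n. 0 < l \<Longrightarrow> l \<le> 1 \<Longrightarrow> P l n (sh l n, mm l n)"
    using that[of "\<lambda>l n. fst (SOME p. P l n p)" "\<lambda>l n. snd (SOME p. P l n p)"] by simp
  have S: "0 < sh l n \<and> sh l n \<le> l / 2 \<and> 1 \<le> real (mm l n) * sh l n powr s"
    and S': "0 \<le> a \<Longrightarrow> a + l \<le> 1 \<Longrightarrow>
          \<exists>Y. spread C s a l (sh l n) Y \<and> card Y = mm l n \<and> (\<forall>y\<in>Y. {y..y+sh l n} \<subseteq> E n)"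
    if "0 < l" "l \<le> 1" for l n a
    using SP[OF that, of n] by (auto simp: P_def)
  define l where "l = rec_nat 1 (\<lambda>k x. sh x k)"
  have l0: "l 0 = 1" and lS: "l (Suc k) = sh (l k) k" for k by (simp_all add: l_def)
  have lp: "0 < l k \<and> l k \<le> 1" for k
  proof (induction k)
    case (Suc k)
    then show ?case using S[of "l k" k] by (auto simp: lS)
  qed (simp add: l0)
  define Y where "Y = (\<lambda>k a. SOME Y. spread C s a (l k) (l (Suc k)) Y \<and> card Y = mm (l k) k \<and>
      (\<forall>y\<in>Y. {y..y+l (Suc k)} \<subseteq> E k))"
  have Y: "spread C s a (l k) (l (Suc k)) (Y k a) \<and> card (Y k a) = mm (l k) k \<and>
      (\<forall>y\<in>Y k a. {y..y+l (Suc k)} \<subseteq> E k)" if "0 \<le> a" "a + l k \<le> 1" for k a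
    unfolding Y_def by (rule someI_ex) (use S'[of "l k" a k] lp[of k] that in \<open>simp add: lS\<close>)
  define L where "L = rec_nat {0} (\<lambda>k X. \<Union>a\<in>X. Y k a)"
  have L0: "L 0 = {0}" and LS: "L (Suc k) = (\<Union>a\<in>L k. Y k a)" for k by (simp_all add: L_def)
  have Lp: "\<forall>a \<in> L k. 0 \<le> a \<and> a + l k \<le> 1" for k
  proof (induction k)
    case (Suc k)
    show ?case
    proof
      fix y assume "y \<in> L (Suc k)"
      then obtain a where a: "a \<in> L k" "y \<in> Y k a" by (auto simp: LS)
      with Suc Y[of a k] show "0 \<le> y \<and> y + l (Suc k) \<le> 1"
        by (force simp: spread_def)
    qed
  qed (simp add: l0 L0)
  have Yp: "spread C s a (l k) (l (Suc k)) (Y k a)" "card (Y k a) = mm (l k) k"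
      "y \<in> Y k a \<Longrightarrow> {y..y+l (Suc k)} \<subseteq> E k" if "a \<in> L k" for k a y
    using Y[of a k] Lp[of k] that by blast+
  show ?thesis
  proof (rule that[of l "\<lambda>k. mm (l k) k" L Y])
    show "0 \<le> a \<and> a + l k \<le> 1" if "a \<in> L k" for k a using Lp[of k] that by blast
  qed (use lp l0 S[of "l k" k for k] L0 LS Yp in \<open>simp_all only: lS[symmetric]\<close>)
qed

lemma bounded_subset_open_interval:
  fixes U :: "real set"
  assumes "bounded U" "diameter U < r"
  shows "\<exists>x. U \<subseteq> {x - r <..< x + r}"
proof (cases "U = {}")
  case False
  then obtain x where x: "x \<in> U" by blast
  have "y \<in> {x - r <..< x + r}" if "y \<in> U" for y
    using diameter_bounded_bound[OF assms(1) that x] assms(2) by (auto simp: dist_real_def)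
  then show ?thesis by blast
qed auto

text \<open>
  Mass distribution principle in counting form. Every interval of generation \<open>k\<close> has mass
  \<open>1 / M k\<close>, where \<open>M k\<close> is the number of such intervals, and an interval of length \<open>d\<close> meets a
  proportion of at most \<open>3 C d powr s\<close> of each sufficiently late generation. Finitely many open
  intervals covering a whole generation, which exist by compactness, therefore have
  \<open>\<Sum> d powr s \<ge> 1 / (3 C)\<close>. The condition \<open>1 \<le> m * l' powr s\<close>, with no constant, keeps the mass of an
  interval below the \<open>s\<close>-th power of its length in all generations, so that \<open>C\<close> enters only once
  and does not accumulate.
\<close>

lemma cantor_positive_measure:
  fixes E :: "nat \<Rightarrow> real set"
  assumes s: "0 < s" and C: "1 \<le> C"
    and step: "\<And>l n. 0 < l \<Longrightarrow> l \<le> 1 \<Longrightarrow>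
      \<exists>l' m. 0 < l' \<and> l' \<le> l / 2 \<and> 1 \<le> real m * l' powr s \<and>
        (\<forall>a. 0 \<le> a \<and> a + l \<le> 1 \<longrightarrow>
          (\<exists>Y. spread C s a l l' Y \<and> card Y = m \<and> (\<forall>y\<in>Y. {y..y+l'} \<subseteq> E n)))"
    and sub: "(\<Inter>n. E n) \<subseteq> A"
  shows "hausdorff_measure s A \<noteq> 0"
proof
  assume null: "hausdorff_measure s A = 0"
  have step': "\<forall>l n. 0 < l \<and> l \<le> 1 \<longrightarrow>
      (\<exists>l' m. 0 < l' \<and> l' \<le> l / 2 \<and> 1 \<le> real m * l' powr s \<and>
        (\<forall>a. 0 \<le> a \<and> a + l \<le> 1 \<longrightarrow>
          (\<exists>Y. spread C s a l l' Y \<and> card Y = m \<and> (\<forall>y\<in>Y. {y..y+l'} \<subseteq> E n))))"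
    using step by blast
  show False
  proof (rule cantor_tree_exists[OF step'])
    fix l :: "nat \<Rightarrow> real" and m L Y
    assume l0: "l 0 = 1" and lpos: "\<And>k. 0 < l k"
      and lhalf: "\<And>k. l (Suc k) \<le> l k / 2" and mass1: "\<And>k. 1 \<le> real (m k) * l (Suc k) powr s"
      and L0: "L 0 = {0}" and LS: "\<And>k. L (Suc k) = (\<Union>a\<in>L k. Y k a)"
      and Lunit: "\<And>k a. a \<in> L k \<Longrightarrow> 0 \<le> a \<and> a + l k \<le> 1"
      and spread: "\<And>k a. a \<in> L k \<Longrightarrow> spread C s a (l k) (l (Suc k)) (Y k a)"
      and cardY: "\<And>k a. a \<in> L k \<Longrightarrow> card (Y k a) = m k"
      and YE: "\<And>k a y. a \<in> L k \<Longrightarrow> y \<in> Y k a \<Longrightarrow> {y..y + l (Suc k)} \<subseteq> E k"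
    have finY: "finite (Y k a)" if "a \<in> L k" for k a using spread[OF that] by (simp add: spread_def)
    have Yin: "a \<le> y" "y + l (Suc k) \<le> a + l k" if "a \<in> L k" "y \<in> Y k a" for k a y
      using spread[OF that(1)] that(2) by (auto simp: spread_def)
    have finL: "finite (L k)" for k
      by (induction k) (auto simp: L0 LS finY)
    have sepL: "l k < b - a" if "a \<in> L k" "b \<in> L k" "a < b" for k a b
      using that
    proof (induction k arbitrary: a b)
      case (Suc k)
      obtain a' b' where ab: "a' \<in> L k" "a \<in> Y k a'" "b' \<in> L k" "b \<in> Y k b'"
        using Suc.prems by (auto simp: LS)
      consider "a' = b'" | "a' < b'" | "b' < a'" by linarith
      then show ?case
      proof cases
        case 1
        then show ?thesis using spread[OF ab(1)] ab Suc.prems by (auto simp: spread_def)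
      next
        case 2
        then show ?thesis using Suc.IH[OF ab(1,3)] Yin[OF ab(1,2)] Yin[OF ab(3,4)] by linarith
      next
        case 3
        then show ?thesis using Suc.IH[OF ab(3,1)] Yin[OF ab(1,2)] Yin[OF ab(3,4)] lpos[of "Suc k"] Suc.prems
          by linarith
      qed
    qed (simp add: L0)
    have disjY: "Y k a \<inter> Y k b = {}" if "a \<in> L k" "b \<in> L k" "a < b" for k a b
    proof -
      have False if "y \<in> Y k a" "y \<in> Y k b" for y
        using Yin[OF \<open>a \<in> L k\<close> that(1)] Yin[OF \<open>b \<in> L k\<close> that(2)] sepL[OF \<open>a \<in> L k\<close> \<open>b \<in> L k\<close> \<open>a < b\<close>]
          lpos[of "Suc k"] by linarith
      then show ?thesis by blast
    qed
    define M where "M = (\<lambda>k. real (card (L k)))"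
    have MS: "M (Suc k) = M k * real (m k)" for k
    proof -
      have "card (L (Suc k)) = (\<Sum>a\<in>L k. card (Y k a))"
        unfolding LS
      proof (rule card_UN_disjoint[OF finL])
        show "\<forall>i\<in>L k. \<forall>j\<in>L k. i \<noteq> j \<longrightarrow> Y k i \<inter> Y k j = {}"
          using disjY[of _ k] by (metis inf_commute linorder_neqE_linordered_idom)
      qed (simp add: finY)
      then show ?thesis by (simp add: M_def cardY)
    qed
    have Mpos: "1 \<le> M k" for k
    proof (induction k)
      case (Suc k)
      have "0 < real (m k) * l (Suc k) powr s" using mass1[of k] by linarith
      then have "1 \<le> m k" by (simp add: zero_less_mult_iff Suc_leI)
      then show ?case using Suc mult_mono[of 1 "M k" 1 "real (m k)"] by (simp add: MS)
    qed (simp add: M_def L0)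
    \<comment> \<open>The mass \<open>1 / M k\<close> of an interval of generation \<open>k\<close> is at most \<open>l k powr s\<close>.\<close>
    have mass: "1 \<le> M k * l k powr s" for k
    proof (induction k)
      case (Suc k)
      have "1 * 1 \<le> M k * (real (m k) * l (Suc k) powr s)"
        using Mpos[of k] mass1[of k] by (intro mult_mono) auto
      then show ?case by (simp add: MS mult.assoc)
    qed (simp add: M_def L0 l0)
    define hit where "hit = (\<lambda>k x d. {a \<in> L k. a \<le> x + d \<and> x \<le> a + l k})"
    have finhit: "finite (hit k x d)" for k x d using finL[of k] by (simp add: hit_def)
    define hitY where "hitY = (\<lambda>k a x d. {y \<in> Y k a. y \<le> x + d \<and> x \<le> y + l (Suc k)})"
    have hitS: "hit (Suc k) x d \<subseteq> (\<Union>a\<in>hit k x d. hitY k a x d)" for k x d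
      using Yin by (fastforce simp: hit_def hitY_def LS)
    have finhitY: "finite (hitY k a x d)" if "a \<in> L k" for k a x d
      using finY[OF that] by (simp add: hitY_def)
    have hit_children: "real (card (hit (Suc k) x d)) \<le> real (card (hit k x d)) * B"
      if "\<And>a. a \<in> L k \<Longrightarrow> real (card (hitY k a x d)) \<le> B" for k x d B
    proof -
      have "card (hit (Suc k) x d) \<le> card (\<Union>a\<in>hit k x d. hitY k a x d)"
        by (rule card_mono[OF _ hitS]) (auto simp: finhit hit_def finL intro!: finhitY)
      also have "\<dots> \<le> (\<Sum>a\<in>hit k x d. card (hitY k a x d))"
        by (rule card_UN_le[OF finhit])
      finally have "real (card (hit (Suc k) x d)) \<le> (\<Sum>a\<in>hit k x d. real (card (hitY k a x d)))"
        by (simp flip: of_nat_sum)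
      also have "\<dots> \<le> (\<Sum>a\<in>hit k x d. B)" by (rule sum_mono) (auto simp: hit_def intro: that)
      finally show ?thesis by simp
    qed
    have hit_frac: "real (card (hit n x d)) \<le> real (card (hit k x d)) * (M n / M k)" if "k \<le> n" for n k x d
      using that
    proof (induction n rule: dec_induct)
      case base
      then show ?case using Mpos[of k] by simp
    next
      case (step n)
      have "real (card (hitY n a x d)) \<le> real (m n)" if "a \<in> L n" for a
        using card_mono[OF finY[OF that], of "hitY n a x d"] cardY[OF that] by (auto simp: hitY_def)
      then have "real (card (hit (Suc n) x d)) \<le> real (card (hit n x d)) * real (m n)"
        by (rule hit_children)
      also have "\<dots> \<le> real (card (hit k x d)) * (M n / M k) * real (m n)"
        using step by (intro mult_right_mono) auto
      finally show ?case by (simp add: MS mult_ac)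
    qed
    have llim: "\<exists>k. l k \<le> d" if d: "0 < d" for d
    proof -
      have "l k \<le> (1/2)^k" for k
        by (induction k) (use lhalf in \<open>auto simp: l0 intro: order_trans\<close>)
      moreover obtain k where "(1/2::real)^k < d" using real_arch_pow_inv[OF d, of "1/2"] by auto
      ultimately show ?thesis by (meson less_imp_le order_trans)
    qed
    have lmono: "l (Suc k) \<le> l k" for k using lhalf[of k] lpos[of k] by linarith
    \<comment> \<open>Compare with the generation \<open>k\<close> such that \<open>d\<close> lies between \<open>l (Suc k)\<close> and \<open>l k\<close>: at most
       three of its intervals are met, and their children are spread.\<close>
    have key: "\<exists>k. \<forall>n\<ge>k. real (card (hit n x d)) \<le> 3 * C * d powr s * M n" if d: "0 < d" for x d
    proof (cases "d \<le> 1")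
      case False
      have "real (card (hit n x d)) \<le> 3 * C * d powr s * M n" for n
      proof -
        have "1 \<le> d powr s" using False s by (simp add: ge_one_powr_ge_zero)
        then have "1 * 1 \<le> (3 * C) * d powr s" using C by (intro mult_mono) auto
        then have "1 * M n \<le> 3 * C * d powr s * M n" using Mpos[of n] by (intro mult_right_mono) auto
        moreover have "card (hit n x d) \<le> card (L n)" by (rule card_mono[OF finL]) (auto simp: hit_def)
        ultimately show ?thesis by (simp add: M_def)
      qed
      then show ?thesis by blast
    next
      case True
      define k where "k = (LEAST k. l (Suc k) \<le> d)"
      have "\<exists>k. l (Suc k) \<le> d" using llim[OF d] lmono by (meson order_trans)
      then have k1: "l (Suc k) \<le> d" unfolding k_def by (rule LeastI_ex)
      have k2: "d \<le> l k"
      proof (cases k)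
        case (Suc j)
        then have "\<not> l (Suc j) \<le> d" using not_less_Least[of j "\<lambda>k. l (Suc k) \<le> d"] by (simp add: k_def)
        then show ?thesis by (simp add: Suc)
      qed (simp add: l0 True)
      have "real (card (hit k x d)) \<le> (2 * l k) / l k + 1"
        by (rule card_separated_le(2)[where x = "x - l k"])
          (use lpos[of k] k2 sepL in \<open>auto simp: hit_def less_imp_le\<close>)
      then have c3: "real (card (hit k x d)) \<le> 3" using lpos[of k] by simp
      have "real (card (hitY k a x d)) \<le> C * real (m k) * (d / l k) powr s" if "a \<in> L k" for a
        using spread[OF that] k1 k2 cardY[OF that] by (auto simp: spread_def hitY_def)
      then have "real (card (hit (Suc k) x d)) \<le> real (card (hit k x d)) * (C * real (m k) * (d / l k) powr s)"
        by (rule hit_children)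
      also have "\<dots> \<le> 3 * (C * real (m k) * (d / l k) powr s)"
        using c3 C by (intro mult_right_mono) auto
      also have "\<dots> = 3 * C * real (m k) * d powr s / l k powr s"
        using d lpos[of k] by (simp add: powr_divide)
      also have "\<dots> \<le> 3 * C * real (m k) * d powr s * M k"
      proof -
        have "1 / l k powr s \<le> M k" using mass[of k] lpos[of k] by (simp add: field_simps)
        then have "3 * C * real (m k) * d powr s * (1 / l k powr s) \<le> 3 * C * real (m k) * d powr s * M k"
          using C by (intro mult_left_mono) auto
        then show ?thesis by simp
      qed
      finally have h: "real (card (hit (Suc k) x d)) \<le> 3 * C * d powr s * M (Suc k)"
        by (simp add: MS mult_ac)
      have "real (card (hit n x d)) \<le> 3 * C * d powr s * M n" if "Suc k \<le> n" for n
      proof -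
        have "real (card (hit n x d)) \<le> real (card (hit (Suc k) x d)) * (M n / M (Suc k))"
          by (rule hit_frac[OF that])
        also have "\<dots> \<le> 3 * C * d powr s * M (Suc k) * (M n / M (Suc k))"
          using h Mpos[of n] Mpos[of "Suc k"] by (intro mult_right_mono) auto
        finally show ?thesis using Mpos[of "Suc k"] by simp
      qed
      then show ?thesis by blast
    qed
    define K where "K = (\<lambda>k. \<Union>a\<in>L k. {a..a + l k})"
    have Kcomp: "compact (K k)" for k unfolding K_def using finL by (intro compact_UN) auto
    have KS: "K (Suc k) \<subseteq> K k" for k
    proof
      fix x assume "x \<in> K (Suc k)"
      then obtain a y where ay: "a \<in> L k" "y \<in> Y k a" "y \<le> x" "x \<le> y + l (Suc k)"
        by (auto simp: K_def LS)
      then have "x \<in> {a..a + l k}" using Yin[OF ay(1,2)] by simp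
      then show "x \<in> K k" using ay(1) by (auto simp: K_def)
    qed
    have Kdec: "K n \<subseteq> K k" if "k \<le> n" for k n
      using lift_Suc_antimono_le[of K, OF KS that] .
    have KE: "(\<Inter>k. K k) \<subseteq> A"
    proof -
      have "K (Suc k) \<subseteq> E k" for k
        unfolding K_def LS using YE by blast
      then have "(\<Inter>k. K k) \<subseteq> (\<Inter>k. E k)" by (meson INF_mono' INT_lower INT_greatest UNIV_I order_trans)
      then show ?thesis using sub by (rule order_trans)
    qed
    \<comment> \<open>Passing to open intervals doubles the diameters and adds at most \<open>c\<close> in total, so a cover of
       size below \<open>c\<close> yields a sum of at most \<open>(2 powr s + 1) c = 1 / (6 C)\<close>, half of what is necessary.\<close>
    define c where "c = 1 / (6 * C * (2 powr s + 1))"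
    have c: "0 < c" using C by (simp add: c_def add_pos_pos)
    have "hausdorff_premeasure s 1 A < ennreal c"
      using null c by (simp add: hausdorff_measure_eq_0_iff)
    then obtain U where U: "U \<in> delta_covers 1 A" and Us: "(\<Sum>i. gauge_power s (U i)) < ennreal c"
      unfolding hausdorff_premeasure_def by (auto simp: INF_less_iff)
    have gauge: "gauge_power s (U i) = ennreal (diameter (U i) powr s)" for i
      using s by (simp add: gauge_power_def)
    have "\<exists>r. diameter (U i) < r \<and> (2 * r) powr s \<le> (2 * diameter (U i)) powr s + c * (1/2)^Suc i" for i
    proof -
      have D0: "0 \<le> diameter (U i)" using U by (intro diameter_ge_0) (auto simp: delta_covers_def)
      have "((\<lambda>r. (2 * r) powr s) \<longlongrightarrow> (2 * diameter (U i)) powr s) (at_right (diameter (U i)))"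
        using D0 s by (intro tendsto_powr' tendsto_intros)
           (auto intro: eventually_mono[OF eventually_at_right_less[of "0::real"]])
      then have "eventually (\<lambda>r. (2 * r) powr s < (2 * diameter (U i)) powr s + c * (1/2)^Suc i)
          (at_right (diameter (U i)))"
        by (rule order_tendstoD) (use c in simp)
      then have "eventually (\<lambda>r. (2 * r) powr s < (2 * diameter (U i)) powr s + c * (1/2)^Suc i
          \<and> diameter (U i) < r) (at_right (diameter (U i)))"
        using eventually_at_right_less[of "diameter (U i)"] by (rule eventually_conj)
      from eventually_happens'[OF _ this] show ?thesis by (auto intro: less_imp_le)
    qed
    then obtain r where r: "\<And>i. diameter (U i) < r i"
      and rs: "\<And>i. (2 * r i) powr s \<le> (2 * diameter (U i)) powr s + c * (1/2)^Suc i" by metis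
    have D0: "0 \<le> diameter (U i)" for i using U by (intro diameter_ge_0) (auto simp: delta_covers_def)
    have rpos: "0 < r i" for i using D0[of i] r[of i] by linarith
    have "\<exists>x. U i \<subseteq> {x - r i <..< x + r i}" for i
      using U r by (intro bounded_subset_open_interval) (auto simp: delta_covers_def)
    then obtain x where x: "\<And>i. U i \<subseteq> {x i - r i <..< x i + r i}" by metis
    define V where "V = (\<lambda>i. {x i - r i <..< x i + r i})"
    have AV: "A \<subseteq> (\<Union>i. V i)" using U x by (fastforce simp: delta_covers_def V_def)
    \<comment> \<open>Compactness is applied twice: some generation is already contained in the open cover, and then
       in a finite part of it.\<close>
    obtain n0 where n0: "K n0 \<subseteq> (\<Union>i. V i)"
    proof (rule ccontr)
      assume "\<not> thesis"
      then have ne: "K n - (\<Union>i. V i) \<noteq> {}" for n using that by blast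
      have "(\<Inter>n. K n - (\<Union>i. V i)) \<noteq> {}"
      proof (rule compact_nest)
        show "compact (K n - (\<Union>i. V i))" for n
          by (intro compact_diff Kcomp open_UN) (simp add: V_def)
        show "K n - (\<Union>i. V i) \<subseteq> K k - (\<Union>i. V i)" if "k \<le> n" for k n
          using Kdec[OF that] by blast
      qed (rule ne)
      then obtain z where "z \<in> (\<Inter>n. K n - (\<Union>i. V i))" unfolding ex_in_conv[symmetric] ..
      then have z: "z \<in> K n - (\<Union>i. V i)" for n by (rule INT_D) simp
      have "z \<in> (\<Inter>k. K k)" using z by (intro INT_I) (rule DiffD1)
      then show False by (rule DiffD2[OF z[of 0] subsetD[OF AV subsetD[OF KE]]])
    qed
    obtain I where I: "finite I" "K n0 \<subseteq> (\<Union>i\<in>I. V i)"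
      using compactE_image[OF Kcomp[of n0], of UNIV V] n0 by (auto simp: V_def)
    have "\<forall>i. \<exists>k. \<forall>n\<ge>k. real (card (hit n (x i - r i) (2 * r i))) \<le> 3 * C * (2 * r i) powr s * M n"
      using key rpos by simp
    then obtain k where k: "\<And>i n. k i \<le> n \<Longrightarrow>
        real (card (hit n (x i - r i) (2 * r i))) \<le> 3 * C * (2 * r i) powr s * M n" by metis
    define n where "n = n0 + sum k I"
    have kn: "k i \<le> n" if "i \<in> I" for i
      using member_le_sum[of i I k] I(1) that by (simp add: n_def)
    have "L n \<subseteq> (\<Union>i\<in>I. hit n (x i - r i) (2 * r i))"
    proof
      fix a assume a: "a \<in> L n"
      then have "a \<in> K n" using lpos[of n] by (auto simp: K_def intro!: bexI[of _ a])
      then have "a \<in> K n0" using Kdec[of n0 n] by (auto simp: n_def)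
      then obtain i where "i \<in> I" "a \<in> V i" using I by blast
      then show "a \<in> (\<Union>i\<in>I. hit n (x i - r i) (2 * r i))"
        using a lpos[of n] by (intro UN_I[of i]) (auto simp: hit_def V_def)
    qed
    then have "card (L n) \<le> card (\<Union>i\<in>I. hit n (x i - r i) (2 * r i))"
      by (intro card_mono) (auto simp: I finhit)
    also have "\<dots> \<le> (\<Sum>i\<in>I. card (hit n (x i - r i) (2 * r i)))" by (rule card_UN_le[OF I(1)])
    finally have "M n \<le> (\<Sum>i\<in>I. real (card (hit n (x i - r i) (2 * r i))))"
      by (simp add: M_def flip: of_nat_sum)
    also have "\<dots> \<le> (\<Sum>i\<in>I. 3 * C * (2 * r i) powr s * M n)" by (intro sum_mono k kn)
    also have "\<dots> = (3 * C * (\<Sum>i\<in>I. (2 * r i) powr s)) * M n"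
      by (simp add: sum_distrib_left sum_distrib_right mult_ac)
    finally have "1 \<le> 3 * C * (\<Sum>i\<in>I. (2 * r i) powr s)"
      using Mpos[of n] by (simp add: mult_le_cancel_right1)
    also have "\<dots> \<le> 3 * C * ((2 powr s + 1) * c)"
    proof (intro mult_left_mono)
      have 1: "(\<Sum>i\<in>I. diameter (U i) powr s) \<le> c"
      proof -
        have "ennreal (\<Sum>i\<in>I. diameter (U i) powr s) = (\<Sum>i\<in>I. gauge_power s (U i))"
          by (simp add: gauge sum_ennreal)
        also have "\<dots> \<le> (\<Sum>i. gauge_power s (U i))"
          by (rule sum_le_suminf) (auto simp: I)
        finally have "ennreal (\<Sum>i\<in>I. diameter (U i) powr s) \<le> ennreal c" using Us by simp
        then show ?thesis using c by (simp add: ennreal_le_iff)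
      qed
      have 2: "(\<Sum>i\<in>I. c * (1/2)^Suc i) \<le> c"
      proof -
        have "(\<Sum>i\<in>I. c * (1/2)^Suc i) \<le> (\<Sum>i. c * (1/2)^Suc i)"
          using c sums_mult[OF power_half_series, of c] I by (intro sum_le_suminf) (auto simp: sums_iff)
        also have "\<dots> = c" using sums_mult[OF power_half_series, of c] by (simp add: sums_iff)
        finally show ?thesis .
      qed
      have "(\<Sum>i\<in>I. (2 * r i) powr s) \<le> (\<Sum>i\<in>I. (2 * diameter (U i)) powr s + c * (1/2)^Suc i)"
        by (intro sum_mono rs)
      also have "\<dots> = 2 powr s * (\<Sum>i\<in>I. diameter (U i) powr s) + (\<Sum>i\<in>I. c * (1/2)^Suc i)"
        by (simp add: sum.distrib sum_distrib_left powr_mult D0)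
      also have "\<dots> \<le> 2 powr s * c + c" using 1 2 by (intro add_mono mult_left_mono) auto
      finally show "(\<Sum>i\<in>I. (2 * r i) powr s) \<le> (2 powr s + 1) * c" by (simp add: algebra_simps)
    qed (use C in auto)
    also have "\<dots> = 1 / 2"
    proof -
      have "2 powr s + 1 > 0" by (simp add: add_pos_pos)
      then show ?thesis using C by (simp add: c_def)
    qed
    finally show False by simp
  qed
qed

section \<open>Counting reduced fractions\<close>

text \<open>
  A fraction \<open>u/v\<close> is represented by the pair \<open>(v, u)\<close>, denominator first.
\<close>

definition frac_pairs :: "real \<Rightarrow> real \<Rightarrow> nat \<Rightarrow> (nat \<times> nat) set" where
  "frac_pairs a l n = (SIGMA v:{1..n}. {u. a * real v \<le> real u \<and> real u \<le> (a + l) * real v})"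

lemma nats_between:
  fixes x y :: real
  assumes "0 \<le> x" "x \<le> y"
  shows "finite {u::nat. x \<le> real u \<and> real u \<le> y}"
    and "y - x - 1 \<le> real (card {u::nat. x \<le> real u \<and> real u \<le> y})"
    and "real (card {u::nat. x \<le> real u \<and> real u \<le> y}) \<le> y - x + 1"
proof -
  have eq: "{u::nat. x \<le> real u \<and> real u \<le> y} = {nat \<lceil>x\<rceil>..nat \<lfloor>y\<rfloor>}"
    using assms by (auto simp: le_nat_iff le_floor_iff ceiling_le_iff)
  show "finite {u::nat. x \<le> real u \<and> real u \<le> y}" unfolding eq by simp
  have "\<lceil>x\<rceil> \<le> \<lfloor>y\<rfloor> + 1" "0 \<le> \<lceil>x\<rceil>" "0 \<le> \<lfloor>y\<rfloor>" using assms by linarith+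
  moreover from this have "nat \<lceil>x\<rceil> \<le> Suc (nat \<lfloor>y\<rfloor>)" by linarith
  ultimately have "real (card {nat \<lceil>x\<rceil>..nat \<lfloor>y\<rfloor>}) = of_int (\<lfloor>y\<rfloor> - \<lceil>x\<rceil> + 1)"
    by (simp only: card_atLeastAtMost of_nat_diff of_nat_Suc of_nat_nat)
  moreover have "y - x - 1 \<le> of_int (\<lfloor>y\<rfloor> - \<lceil>x\<rceil> + 1)" "of_int (\<lfloor>y\<rfloor> - \<lceil>x\<rceil> + 1) \<le> y - x + 1"
    by linarith+
  ultimately show "y - x - 1 \<le> real (card {u::nat. x \<le> real u \<and> real u \<le> y})"
    and "real (card {u::nat. x \<le> real u \<and> real u \<le> y}) \<le> y - x + 1"
    unfolding eq by linarith+
qed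

lemma card_frac_pairs:
  assumes "0 \<le> a" "0 \<le> l" "l \<le> 1"
  shows "finite (frac_pairs a l n)"
    and "l * real n ^ 2 / 2 - real n \<le> real (card (frac_pairs a l n))"
    and "real (card (frac_pairs a l n)) \<le> l * real n ^ 2 / 2 + 2 * real n"
proof -
  define N where "N = (\<lambda>v. {u::nat. a * real v \<le> real u \<and> real u \<le> (a + l) * real v})"
  have le: "a * real v \<le> (a + l) * real v" "0 \<le> a * real v" for v
    using assms by (auto intro: mult_right_mono)
  have fin: "finite (N v)" for v unfolding N_def by (rule nats_between(1)[OF le(2,1)])
  then show "finite (frac_pairs a l n)"
    unfolding frac_pairs_def by (intro finite_SigmaI) (auto simp: N_def)
  have card: "real (card (frac_pairs a l n)) = (\<Sum>v=1..n. real (card (N v)))"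
    unfolding frac_pairs_def N_def[symmetric] using fin by simp
  have gauss: "(\<Sum>v=1..n. real v) = real n * (real n + 1) / 2"
    by (induction n) (auto simp: field_simps)
  have "(\<Sum>v=1..n. l * real v - 1) \<le> real (card (frac_pairs a l n))"
    unfolding card N_def
    by (intro sum_mono) (use nats_between(2)[OF le(2,1)] in \<open>simp add: algebra_simps\<close>)
  moreover have "(\<Sum>v=1..n. l * real v - 1) = l * (real n * (real n + 1) / 2) - real n"
    by (simp only: sum_subtractf sum_distrib_left[symmetric] gauss) simp
  ultimately show "l * real n ^ 2 / 2 - real n \<le> real (card (frac_pairs a l n))"
    using mult_nonneg_nonneg[OF assms(2) of_nat_0_le_iff[of n]]
    by (simp add: power2_eq_square algebra_simps)
  have "real (card (frac_pairs a l n)) \<le> (\<Sum>v=1..n. l * real v + 1)"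
    unfolding card N_def
    by (intro sum_mono) (use nats_between(3)[OF le(2,1)] in \<open>simp add: algebra_simps\<close>)
  also have "\<dots> = l * (real n * (real n + 1) / 2) + real n"
    by (simp only: sum.distrib sum_distrib_left[symmetric] gauss) simp
  also have "l * real n \<le> real n" using assms by (simp add: mult_left_le_one_le)
  then have "l * (real n * (real n + 1) / 2) + real n \<le> l * real n ^ 2 / 2 + 2 * real n"
    by (simp add: power2_eq_square algebra_simps)
  finally show "real (card (frac_pairs a l n)) \<le> l * real n ^ 2 / 2 + 2 * real n" .
qed

lemma sum_inverse_squares_from_2: "(\<Sum>d=2..n. 1 / real d ^ 2) \<le> 3 / 4"
proof -
  have "(\<Sum>d=2..n. 1 / real d ^ 2) \<le> 3 / 4 - 1 / real n" if "2 \<le> n"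
    using that
  proof (induction n rule: dec_induct)
    case (step n)
    have "1 / real (Suc n) ^ 2 \<le> 1 / (real n * real (Suc n))"
      using step by (intro divide_left_mono) (auto simp: power2_eq_square)
    also have "\<dots> = 1 / real n - 1 / real (Suc n)"
      using step by (simp add: field_simps)
    finally show ?case using step by simp
  qed simp
  moreover have "0 \<le> 1 / real n" by simp
  ultimately show ?thesis by (cases "2 \<le> n") (linarith, simp)
qed

lemma sum_inverse_le_sqrt: "(\<Sum>d=1..n. 1 / real d) \<le> 2 * sqrt (real n)"
proof (induction n)
  case (Suc n)
  have "1 / real (Suc n) \<le> 2 * (sqrt (real (Suc n)) - sqrt (real n))"
  proof -
    define x y where "x = sqrt (real (Suc n))" and "y = sqrt (real n)"
    have xy: "x * x = y * y + 1" "0 \<le> y" "y \<le> x" "1 \<le> x" by (auto simp: x_def y_def)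
    then have "(x - y) * (x + y) = 1" by (simp add: algebra_simps)
    moreover have "(x - y) * (x + y) \<le> (x - y) * (2 * x)" using xy by (intro mult_left_mono) auto
    ultimately have "1 / x \<le> 2 * (x - y)" using xy by (simp add: field_simps)
    moreover have "1 / (x * x) \<le> 1 / x"
      using xy(4) mult_left_mono[OF xy(4), of x] by (intro divide_left_mono) auto
    moreover have "x * x = real (Suc n)" by (simp add: x_def)
    ultimately show ?thesis unfolding x_def[symmetric] y_def[symmetric] by simp
  qed
  then show ?case using Suc by simp
qed simp

definition reduced_pairs :: "real \<Rightarrow> real \<Rightarrow> nat \<Rightarrow> (nat \<times> nat) set" where
  "reduced_pairs a l V = {(v, u) \<in> frac_pairs a l V. coprime u v \<and> V < 4 * v}"

text \<open>
  A pair that is not reduced is a multiple by some \<open>d \<ge> 2\<close> of a pair with denominator at most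
  \<open>V div d\<close>. As \<open>\<Sum> 1/d\<^sup>2 \<le> 3/4\<close> over \<open>d \<ge> 2\<close>, such pairs make up at most three quarters of the main term
  \<open>l V\<^sup>2 / 2\<close>, and the pairs with \<open>v \<le> V/4\<close> at most one sixteenth, which leaves
  \<open>3/16\<close> of it.
\<close>

lemma card_reduced_pairs:
  assumes "0 \<le> a" "0 \<le> l" "l \<le> 1"
  shows "3 / 32 * l * real V ^ 2 - 4 * real V * sqrt (real V) - 2 * real V
           \<le> real (card (reduced_pairs a l V))"
proof -
  define img where "img = (\<lambda>d. (\<lambda>(v, u). (d * v, d * u)) ` frac_pairs a l (V div d))"
  have fin: "finite (frac_pairs a l n)" for n using card_frac_pairs(1)[OF assms] .
  have finimg: "finite (img d)" for d by (simp add: img_def fin)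
  have sub: "frac_pairs a l V \<subseteq> reduced_pairs a l V \<union> frac_pairs a l (V div 4) \<union> (\<Union>d\<in>{2..V}. img d)"
  proof (rule subsetI, clarify)
    fix v u assume vu: "(v, u) \<in> frac_pairs a l V" "(v, u) \<notin> (\<Union>d\<in>{2..V}. img d)"
      and n4: "(v, u) \<notin> frac_pairs a l (V div 4)"
    from vu have v: "1 \<le> v" "v \<le> V" and u: "a * real v \<le> real u" "real u \<le> (a + l) * real v"
      by (auto simp: frac_pairs_def)
    have "coprime u v"
    proof (rule ccontr)
      assume nc: "\<not> coprime u v"
      define d where "d = gcd u v"
      have d0: "d > 0" using v by (simp add: d_def)
      have "d \<noteq> 1" using nc by (simp add: d_def coprime_iff_gcd_eq_1)
      then have d2: "2 \<le> d" using d0 by simp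
      obtain u' v' where uv: "u = d * u'" "v = d * v'" by (metis d_def dvd_def gcd_dvd1 gcd_dvd2)
      have dV: "d \<le> V" using v uv by (metis d_def dvd_imp_le gcd_dvd2 le_trans less_le_trans zero_less_one)
      have "1 \<le> v'" using v uv by (cases v') auto
      moreover have "v' \<le> V div d" using v uv d0 by (simp add: less_eq_div_iff_mult_less_eq mult.commute)
      moreover have "a * real v' \<le> real u'" "real u' \<le> (a + l) * real v'"
        using u d0 by (simp_all add: uv mult.left_commute)
      ultimately have "(v', u') \<in> frac_pairs a l (V div d)" by (simp add: frac_pairs_def)
      then have "(v, u) \<in> img d" using uv by (force simp: img_def)
      then show False using vu d2 dV by auto
    qed
    moreover have "V < 4 * v" using n4 v u by (auto simp: frac_pairs_def)
    ultimately show "(v, u) \<in> reduced_pairs a l V" using vu by (simp add: reduced_pairs_def)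
  qed
  have finr: "finite (reduced_pairs a l V)" by (rule finite_subset[OF _ fin[of V]]) (auto simp: reduced_pairs_def)
  have "card (frac_pairs a l V) \<le> card (reduced_pairs a l V \<union> frac_pairs a l (V div 4) \<union> (\<Union>d\<in>{2..V}. img d))"
    by (intro card_mono sub) (auto simp: fin finr finimg)
  also have "\<dots> \<le> card (reduced_pairs a l V) + card (frac_pairs a l (V div 4)) + card (\<Union>d\<in>{2..V}. img d)"
    by (metis (no_types, lifting) add_mono card_Un_le le_refl order_trans)
  also have "card (\<Union>d\<in>{2..V}. img d) \<le> (\<Sum>d=2..V. card (img d))"
    by (rule card_UN_le) simp
  also have "\<dots> \<le> (\<Sum>d=2..V. card (frac_pairs a l (V div d)))"
    by (intro sum_mono) (auto simp: img_def intro: card_image_le fin)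
  finally have "real (card (frac_pairs a l V)) \<le> real (card (reduced_pairs a l V)) +
      real (card (frac_pairs a l (V div 4))) + (\<Sum>d=2..V. real (card (frac_pairs a l (V div d))))"
    by (simp flip: of_nat_sum of_nat_add)
  moreover have "l * real V ^ 2 / 2 - real V \<le> real (card (frac_pairs a l V))"
    by (rule card_frac_pairs(2)[OF assms])
  moreover have part: "real (card (frac_pairs a l (V div d))) \<le> l * real V ^ 2 / 2 * (1 / real d ^ 2) + 2 * real V * (1 / real d)"
    if "1 \<le> d" for d
  proof -
    have q: "real (V div d) \<le> real V / real d" by (rule of_nat_div_le_of_nat)
    have "real (card (frac_pairs a l (V div d))) \<le> l * real (V div d) ^ 2 / 2 + 2 * real (V div d)"
      by (rule card_frac_pairs(3)[OF assms])
    also have "\<dots> \<le> l * (real V / real d) ^ 2 / 2 + 2 * (real V / real d)"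
      using q assms by (intro add_mono divide_right_mono mult_left_mono power_mono) auto
    finally show ?thesis by (simp add: power_divide)
  qed
  moreover have "(\<Sum>d=2..V. real (card (frac_pairs a l (V div d)))) \<le> 3 / 8 * l * real V ^ 2 + 4 * real V * sqrt (real V)"
  proof -
    have "(\<Sum>d=2..V. real (card (frac_pairs a l (V div d))))
       \<le> (\<Sum>d=2..V. l * real V ^ 2 / 2 * (1 / real d ^ 2) + 2 * real V * (1 / real d))"
      by (intro sum_mono part) auto
    also have "\<dots> = l * real V ^ 2 / 2 * (\<Sum>d=2..V. 1 / real d ^ 2) + 2 * real V * (\<Sum>d=2..V. 1 / real d)"
      by (simp only: sum.distrib sum_distrib_left)
    also have "\<dots> \<le> l * real V ^ 2 / 2 * (3 / 4) + 2 * real V * (2 * sqrt (real V))"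
    proof (intro add_mono mult_left_mono sum_inverse_squares_from_2)
      have "(\<Sum>d=2..V. 1 / real d) \<le> (\<Sum>d=1..V. 1 / real d)" by (intro sum_mono2) auto
      then show "(\<Sum>d=2..V. 1 / real d) \<le> 2 * sqrt (real V)" using sum_inverse_le_sqrt[of V] by linarith
    qed (use assms in auto)
    finally show ?thesis by simp
  qed
  moreover have "real (card (frac_pairs a l (V div 4))) \<le> l * real V ^ 2 / 32 + real V / 2"
    using part[of 4] by simp
  ultimately show ?thesis by linarith
qed

lemma eventually_many_reduced_pairs:
  assumes "0 < l" "l \<le> 1"
  shows "eventually (\<lambda>V. \<forall>a\<ge>0. l * real V ^ 2 / 16 \<le> real (card (reduced_pairs a l V))) sequentially"
proof -
  have "eventually (\<lambda>V::nat. 4 * real V * sqrt (real V) + 2 * real V \<le> l / 32 * real V ^ 2) sequentially"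
    using assms by real_asymp
  then show ?thesis
  proof eventually_elim
    case (elim V)
    show ?case
    proof (intro allI impI)
      fix a :: real assume "0 \<le> a"
      then show "l * real V ^ 2 / 16 \<le> real (card (reduced_pairs a l V))"
        using card_reduced_pairs[of a l V] elim assms by simp
    qed
  qed
qed

lemma reduced_fractions_separated:
  fixes u v u' v' V :: nat
  assumes "coprime u v" "coprime u' v'" "0 < v" "0 < v'" "v \<le> V" "v' \<le> V" "(v, u) \<noteq> (v', u')"
  shows "1 / real V ^ 2 \<le> \<bar>real u / real v - real u' / real v'\<bar>"
proof -
  have "u * v' \<noteq> u' * v"
  proof
    assume eq: "u * v' = u' * v"
    have "v dvd v'" using eq assms(1) by (metis coprime_commute coprime_dvd_mult_right_iff dvd_triv_right)
    moreover have "v' dvd v" using eq assms(2) by (metis coprime_commute coprime_dvd_mult_right_iff dvd_triv_right)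
    ultimately have "v = v'" by (rule dvd_antisym)
    then show False using eq assms by auto
  qed
  then have "1 \<le> \<bar>int (u * v') - int (u' * v)\<bar>" by linarith
  then have "1 \<le> \<bar>of_int (int (u * v') - int (u' * v)) :: real\<bar>" by linarith
  then have 1: "1 \<le> \<bar>real u * real v' - real u' * real v\<bar>" by simp
  have "real u / real v - real u' / real v' = (real u * real v' - real u' * real v) / (real v * real v')"
    using assms by (simp add: field_simps)
  then have "\<bar>real u / real v - real u' / real v'\<bar> = \<bar>real u * real v' - real u' * real v\<bar> / (real v * real v')"
    by (simp add: abs_mult)
  also have "\<dots> \<ge> 1 / (real v * real v')" using 1 by (intro divide_right_mono) auto
  also have "1 / (real v * real v') \<ge> 1 / real V ^ 2"
    using assms by (intro divide_left_mono) (auto simp: power2_eq_square intro!: mult_mono)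
  finally show ?thesis .
qed

section \<open>Clusters of points near reduced fractions\<close>

text \<open>
  An interval of length \<open>d\<close> meets the clusters of at most \<open>V\<^sup>2 d + 2\<close> fractions, and in
  each cluster at most \<open>min m (2 d / g + 1)\<close> points. If \<open>d > 1/V\<^sup>2\<close>, the first factor is at
  most \<open>3 V\<^sup>2 d\<close>, and comparison with the number of fractions gives a proportion of order \<open>d/l\<close>,
  hence of order \<open>(d/l) powr s\<close>. If \<open>d \<le> 1/V\<^sup>2\<close>, the first factor is at most 3 and the
  hypothesis \<open>scale\<close> bounds the second.
\<close>

lemma spread_around_reduced_fractions:
  fixes V m :: nat and B :: "nat \<times> nat \<Rightarrow> real set"
  defines "r \<equiv> (\<lambda>p :: nat \<times> nat. real (snd p) / real (fst p))"
  assumes s: "0 < s" "s \<le> 1" and l: "0 < l" "l \<le> 1" and a: "0 \<le> a" and V: "0 < V"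
    and R: "R \<subseteq> reduced_pairs a (l / 2) V" "l * real V ^ 2 / 32 \<le> real (card R)"
    and l': "0 < l'" "t + l' \<le> 1 / (2 * real V ^ 2)" "t + l' \<le> l / 2" "l' < g" and t: "0 \<le> t"
    and B: "\<And>p. p \<in> R \<Longrightarrow> card (B p) = m" "\<And>p. p \<in> R \<Longrightarrow> B p \<subseteq> {0..t}" "\<And>p. p \<in> R \<Longrightarrow> finite (B p)"
      "\<And>p b c. p \<in> R \<Longrightarrow> b \<in> B p \<Longrightarrow> c \<in> B p \<Longrightarrow> b < c \<Longrightarrow> g \<le> c - b"
    and scale: "\<And>d. l' \<le> d \<Longrightarrow> d \<le> 1 / real V ^ 2 \<Longrightarrow>
        1 / l * min (real m) (2 * d / g + 1) \<le> real V ^ 2 * real m * d powr s"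
  defines "Y \<equiv> (\<lambda>(p, b). r p + b) ` (SIGMA p:R. B p)"
  shows "card Y = card R * m" "spread 96 s a l l' Y"
proof -
  have finR: "finite R"
    by (rule finite_subset[OF R(1)], rule finite_subset[OF _ card_frac_pairs(1)[of a "l/2" V]])
      (use a l in \<open>auto simp: reduced_pairs_def\<close>)
  have Rp: "a \<le> r p" "r p \<le> a + l / 2" "coprime (snd p) (fst p)" "0 < fst p" "fst p \<le> V"
    if "p \<in> R" for p
    using subsetD[OF R(1) that]
    by (auto simp: reduced_pairs_def frac_pairs_def r_def pos_le_divide_eq pos_divide_le_eq)
  have rsep: "1 / real V ^ 2 \<le> \<bar>r p - r q\<bar>" if "p \<in> R" "q \<in> R" "p \<noteq> q" for p q
    using reduced_fractions_separated[OF Rp(3)[OF that(1)] Rp(3)[OF that(2)] Rp(4)[OF that(1)]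
        Rp(4)[OF that(2)] Rp(5)[OF that(1)] Rp(5)[OF that(2)]] that(3)
    by (auto simp: r_def prod_eq_iff)
  have V2: "0 < 1 / real V ^ 2" using V by simp
  define W where "W = 1 / real V ^ 2"
  have half: "t + l' \<le> W / 2" using l'(2) by (simp add: W_def)
  have ysep: "l' < \<bar>(r p + b) - (r q + c)\<bar>"
    if "p \<in> R" "q \<in> R" "b \<in> B p" "c \<in> B q" "(p, b) \<noteq> (q, c)" for p q b c
  proof (cases "p = q")
    case True
    then have "b \<noteq> c" using that by simp
    then consider "b < c" | "c < b" by linarith
    then show ?thesis
      using B(4)[OF that(1), of b c] B(4)[OF that(1), of c b] that True l' by cases auto
  next
    case False
    have "\<bar>b - c\<bar> \<le> t" using B(2)[OF that(1)] B(2)[OF that(2)] that by force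
    moreover have "\<bar>r p - r q\<bar> \<le> \<bar>(r p + b) - (r q + c)\<bar> + \<bar>b - c\<bar>" by linarith
    ultimately show ?thesis using rsep[OF that(1,2) False] V2[folded W_def] half unfolding W_def[symmetric] by linarith
  qed
  have inj: "inj_on (\<lambda>(p, b). r p + b) (SIGMA p:R. B p)"
    using ysep l'(1) by (fastforce simp: inj_on_def)
  show cardY: "card Y = card R * m"
    unfolding Y_def by (simp add: card_image[OF inj] finR B)
  have finY: "finite Y" unfolding Y_def by (intro finite_imageI finite_SigmaI finR B)
  have "real (card {y\<in>Y. y \<le> x + d \<and> x \<le> y + l'}) \<le> 96 * real (card Y) * (d / l) powr s"
    if d: "l' \<le> d" "d \<le> l" for x d
  proof -
    have d0: "0 < d" using d l' by linarith
    define R' where "R' = {p\<in>R. x - l' - t \<le> r p \<and> r p \<le> x + d}"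
    define B' where "B' = (\<lambda>p. {b\<in>B p. x - l' - r p \<le> b \<and> b \<le> x + d - r p})"
    have finR': "finite R'" using finR by (simp add: R'_def)
    have rinj: "inj_on r R'"
      using rsep V2 by (fastforce simp: inj_on_def R'_def)
    have cR': "real (card R') \<le> real V ^ 2 * d + 2"
    proof -
      have "real (card (r ` R')) \<le> (d + l' + t) / (1 / real V ^ 2) + 1"
      proof (rule card_separated_le(2)[where x = "x - l' - t"])
        fix y z assume "y \<in> r ` R'" "z \<in> r ` R'" "y < z"
        then obtain p q where "y = r p" "z = r q" "p \<in> R" "q \<in> R" "r p < r q"
          by (auto simp: R'_def)
        then show "1 / real V ^ 2 \<le> z - y" using rsep[of p q] by fastforce
      qed (use V2 d0 l' t in \<open>auto simp: R'_def\<close>)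
      also have "\<dots> \<le> (d + 1 / real V ^ 2) / (1 / real V ^ 2) + 1"
        using half V2[folded W_def] t l'(1) unfolding W_def[symmetric]
        by (intro add_right_mono divide_right_mono) linarith+
      also have "\<dots> = real V ^ 2 * d + 2" using V by (simp add: field_simps)
      finally show ?thesis by (simp add: card_image[OF rinj])
    qed
    have cB': "real (card (B' p)) \<le> min (real m) (2 * d / g + 1)" if p: "p \<in> R" for p
    proof -
      have "card (B' p) \<le> card (B p)" by (rule card_mono) (auto simp: B'_def B p)
      moreover have "real (card (B' p)) \<le> (2 * d) / g + 1"
        by (rule card_separated_le(2)[where x = "x - l' - r p"])
          (use d d0 l' B(4)[OF p] in \<open>auto simp: B'_def\<close>)
      ultimately show ?thesis using B(1)[OF p] by simp
    qed
    have finB': "finite (B' p)" if "p \<in> R" for p using B(3)[OF that] by (simp add: B'_def)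
    have "{y\<in>Y. y \<le> x + d \<and> x \<le> y + l'} \<subseteq> (\<lambda>(p, b). r p + b) ` (SIGMA p:R'. B' p)"
    proof
      fix y assume "y \<in> {y\<in>Y. y \<le> x + d \<and> x \<le> y + l'}"
      then obtain p b where pb: "p \<in> R" "b \<in> B p" "y = r p + b" "y \<le> x + d" "x \<le> y + l'"
        by (auto simp: Y_def)
      moreover have "0 \<le> b" "b \<le> t" using B(2)[OF pb(1)] pb(2) by auto
      ultimately have "(p, b) \<in> (SIGMA p:R'. B' p)" by (auto simp: R'_def B'_def)
      then show "y \<in> (\<lambda>(p, b). r p + b) ` (SIGMA p:R'. B' p)" using pb(3) by force
    qed
    then have "card {y\<in>Y. y \<le> x + d \<and> x \<le> y + l'} \<le> card ((\<lambda>(p, b). r p + b) ` (SIGMA p:R'. B' p))"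
      by (intro card_mono finite_imageI finite_SigmaI finR') (auto simp: R'_def intro: finB')
    also have "\<dots> \<le> card (SIGMA p:R'. B' p)"
      by (intro card_image_le finite_SigmaI finR') (auto simp: R'_def intro: finB')
    also have "\<dots> = (\<Sum>p\<in>R'. card (B' p))"
      by (intro card_SigmaI finR') (auto simp: R'_def intro: finB')
    finally have "real (card {y\<in>Y. y \<le> x + d \<and> x \<le> y + l'}) \<le> (\<Sum>p\<in>R'. real (card (B' p)))"
      by (simp flip: of_nat_sum)
    also have "\<dots> \<le> (\<Sum>p\<in>R'. min (real m) (2 * d / g + 1))"
      by (intro sum_mono cB') (auto simp: R'_def)
    also have "\<dots> = real (card R') * min (real m) (2 * d / g + 1)" by simp
    also have "\<dots> \<le> (real V ^ 2 * d + 2) * min (real m) (2 * d / g + 1)"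
      using cR' d0 l' by (intro mult_right_mono) auto
    finally have hits: "real (card {y\<in>Y. y \<le> x + d \<and> x \<le> y + l'})
        \<le> (real V ^ 2 * d + 2) * min (real m) (2 * d / g + 1)" .
    have RV: "3 * (l * real V ^ 2 * real m) \<le> 96 * real (card Y)"
      using mult_right_mono[OF R(2), of "96 * real m"] by (simp add: cardY algebra_simps)
    show ?thesis
    proof (cases "d \<le> 1 / real V ^ 2")
      case True
      have "real V ^ 2 * d \<le> 1" using True V by (simp add: field_simps)
      then have "(real V ^ 2 * d + 2) * min (real m) (2 * d / g + 1) \<le> 3 * min (real m) (2 * d / g + 1)"
        using d0 l' by (intro mult_right_mono) auto
      also have "\<dots> = 3 * l * (1 / l * min (real m) (2 * d / g + 1))" using l by simp
      also have "\<dots> \<le> 3 * l * (real V ^ 2 * real m * d powr s)"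
        using scale[OF d(1) True] l by (intro mult_left_mono) auto
      also have "\<dots> = 3 * (l * real V ^ 2 * real m) * d powr s" by simp
      also have "\<dots> \<le> 96 * real (card Y) * (d / l) powr s"
      proof (rule mult_mono[OF RV])
        show "d powr s \<le> (d / l) powr s"
          using d0 l s by (intro powr_mono2) (auto simp: pos_le_divide_eq mult_left_le)
      qed auto
      finally show ?thesis using hits by linarith
    next
      case False
      then have "1 \<le> real V ^ 2 * d" using V by (simp add: field_simps)
      then have "(real V ^ 2 * d + 2) * min (real m) (2 * d / g + 1) \<le> (3 * (real V ^ 2 * d)) * real m"
        using d0 l' by (intro mult_mono) (linarith | simp)+
      also have "\<dots> = 3 * (l * real V ^ 2 * real m) * (d / l)" using l by simp
      also have "\<dots> \<le> 96 * real (card Y) * (d / l) powr s"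
      proof (rule mult_mono[OF RV])
        show "d / l \<le> (d / l) powr s"
          using powr_mono'[of s 1 "d / l"] d0 d l s by simp
      qed (use d0 l in auto)
      finally show ?thesis using hits by linarith
    qed
  qed
  moreover have "\<forall>y\<in>Y. a \<le> y \<and> y + l' \<le> a + l"
  proof
    fix y assume "y \<in> Y"
    then obtain p b where pb: "p \<in> R" "b \<in> B p" "y = r p + b" by (auto simp: Y_def)
    then show "a \<le> y \<and> y + l' \<le> a + l"
      using Rp[OF pb(1)] B(2)[OF pb(1)] l'(3) by force
  qed
  moreover have "\<forall>y\<in>Y. \<forall>z\<in>Y. y < z \<longrightarrow> l' < z - y"
  proof (intro ballI impI)
    fix y z assume yz: "y \<in> Y" "z \<in> Y" "y < z"
    then obtain p b q c where pb: "p \<in> R" "b \<in> B p" "y = r p + b" "q \<in> R" "c \<in> B q" "z = r q + c"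
      by (auto simp: Y_def)
    then have "(p, b) \<noteq> (q, c)" using yz by auto
    then show "l' < z - y" using ysep[of p q b c] pb yz by auto
  qed
  ultimately show "spread 96 s a l l' Y" using finY by (simp add: spread_def)
qed

text \<open>
  The scheme for both lower bounds: near each reduced fraction \<open>u/v\<close> with \<open>v\<close> of size \<open>V\<close> there is a
  cluster of \<open>m V\<close> short intervals on which the \<open>n\<close>-th approximation property \<open>E n\<close> holds. The constant
  \<open>K\<close> in \<open>scale\<close> absorbs the dependence on the interval of the previous generation, which is fixed
  before \<open>V\<close> is chosen. The intersection with \<open>{..1}\<close> confines the property to be
  checked to the unit interval, where the construction takes place.
\<close>

lemma positive_measure_near_reduced_fractions:
  fixes E :: "nat \<Rightarrow> real set" and m :: "nat \<Rightarrow> nat" and l' g t :: "nat \<Rightarrow> real"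
  assumes s: "0 < s" "s \<le> 1"
    and sizes: "\<forall>\<^sub>F V in sequentially. 0 < l' V \<and> 0 \<le> t V \<and> t V + l' V \<le> 1 / (2 * real V ^ 2) \<and> l' V < g V \<and> 0 < m V"
    and scale: "\<And>K. 0 < K \<Longrightarrow> \<forall>\<^sub>F V in sequentially. \<forall>d. l' V \<le> d \<and> d \<le> 1 / real V ^ 2 \<longrightarrow>
        K * min (real (m V)) (2 * d / g V + 1) \<le> real V ^ 2 * real (m V) * d powr s"
    and near: "\<And>n. \<forall>\<^sub>F V in sequentially. \<forall>u v. coprime u v \<and> V < 4 * v \<and> v \<le> V \<and> u \<le> v \<longrightarrow>
        (\<exists>B. finite B \<and> card B = m V \<and> B \<subseteq> {0..t V} \<and> (\<forall>b\<in>B. \<forall>c\<in>B. b < c \<longrightarrow> g V \<le> c - b) \<and>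
          (\<forall>b\<in>B. {real u / real v + b .. real u / real v + b + l' V} \<inter> {..1} \<subseteq> E n))"
    and sub: "(\<Inter>n. E n) \<subseteq> A"
  shows "hausdorff_measure s A \<noteq> 0"
proof (rule cantor_positive_measure[OF s(1) _ _ sub])
  fix l :: real and n :: nat
  assume l: "0 < l" "l \<le> 1"
  have "\<forall>\<^sub>F V in sequentially. 1 / (2 * real V ^ 2) \<le> l / 2"
    using l by real_asymp
  then have "\<forall>\<^sub>F V in sequentially. 0 < V \<and> 1 / (2 * real V ^ 2) \<le> l / 2 \<and>
      (0 < l' V \<and> 0 \<le> t V \<and> t V + l' V \<le> 1 / (2 * real V ^ 2) \<and> l' V < g V \<and> 0 < m V) \<and>
      (\<forall>d. l' V \<le> d \<and> d \<le> 1 / real V ^ 2 \<longrightarrow>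
        32 / l * min (real (m V)) (2 * d / g V + 1) \<le> real V ^ 2 * real (m V) * d powr s) \<and>
      (\<forall>u v. coprime u v \<and> V < 4 * v \<and> v \<le> V \<and> u \<le> v \<longrightarrow>
        (\<exists>B. finite B \<and> card B = m V \<and> B \<subseteq> {0..t V} \<and> (\<forall>b\<in>B. \<forall>c\<in>B. b < c \<longrightarrow> g V \<le> c - b) \<and>
          (\<forall>b\<in>B. {real u / real v + b .. real u / real v + b + l' V} \<inter> {..1} \<subseteq> E n))) \<and>
      (\<forall>a\<ge>0. l / 2 * real V ^ 2 / 16 \<le> real (card (reduced_pairs a (l / 2) V)))"
    (is "\<forall>\<^sub>F V in sequentially. ?good V")
    using l by (intro eventually_conj eventually_gt_at_top sizes scale near eventually_many_reduced_pairs) auto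
  from eventually_happens'[OF sequentially_bot this] obtain V where good: "?good V" ..
  note good2 = conjunct2[OF conjunct2[OF good]]
  have V: "0 < V" "1 / (2 * real V ^ 2) \<le> l / 2"
    using conjunct1[OF good] conjunct1[OF conjunct2[OF good]] .
  have sz: "0 < l' V" "0 \<le> t V" "t V + l' V \<le> 1 / (2 * real V ^ 2)" "l' V < g V" "0 < m V"
    using conjunct1[OF good2] by simp_all
  note sc = conjunct1[OF conjunct2[OF good2], rule_format, OF conjI]
  note nr = conjunct1[OF conjunct2[OF conjunct2[OF good2]], rule_format, OF conjI[OF _ conjI[OF _ conjI]]]
  have many: "l * real V ^ 2 / 32 \<le> real (card (reduced_pairs a (l / 2) V))" if "0 \<le> a" for a
    using conjunct2[OF conjunct2[OF conjunct2[OF good2]], rule_format, OF that] by simp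
  \<comment> \<open>All intervals of length \<open>l\<close> must get the same number of children, so exactly \<open>N\<close> fractions are
     selected in each. They are taken from its left half, which leaves room for the clusters.\<close>
  define N where "N = nat \<lceil>l * real V ^ 2 / 32\<rceil>"
  have N: "l * real V ^ 2 / 32 \<le> real N" unfolding N_def by linarith
  have sc1: "1 / l * min (real (m V)) (2 * d / g V + 1) \<le> real V ^ 2 * real (m V) * d powr s"
    if "l' V \<le> d" "d \<le> 1 / real V ^ 2" for d
  proof -
    have "1 / l * min (real (m V)) (2 * d / g V + 1) \<le> 32 / l * min (real (m V)) (2 * d / g V + 1)"
      using l that sz by (intro mult_right_mono divide_right_mono) auto
    then show ?thesis using sc[OF that] by linarith
  qed
  have "l' V \<le> 1 / real V ^ 2"
  proof -
    have "1 / (2 * real V ^ 2) = 1 / real V ^ 2 / 2" "0 < 1 / real V ^ 2" using V by simp_all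
    then show ?thesis using sz(2,3) by linarith
  qed
  then have mass: "1 \<le> real (N * m V) * l' V powr s"
  proof -
    have "32 / l * 1 \<le> 32 / l * min (real (m V)) (2 * l' V / g V + 1)"
      using l sz by (intro mult_left_mono) auto
    also have "\<dots> \<le> real V ^ 2 * real (m V) * l' V powr s"
      using sc[OF order_refl] \<open>l' V \<le> 1 / real V ^ 2\<close> by blast
    finally have "1 \<le> (l * real V ^ 2 / 32) * (real (m V) * l' V powr s)"
      using l by (simp add: field_simps)
    also have "\<dots> \<le> real N * (real (m V) * l' V powr s)"
      using N by (intro mult_right_mono) auto
    finally show ?thesis by simp
  qed
  have tree: "\<exists>Y. spread 96 s a l (l' V) Y \<and> card Y = N * m V \<and> (\<forall>y\<in>Y. {y..y + l' V} \<subseteq> E n)"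
    if a: "0 \<le> a" "a + l \<le> 1" for a
  proof -
    have "N \<le> card (reduced_pairs a (l / 2) V)" using many[OF a(1)] unfolding N_def by linarith
    then obtain R where R: "R \<subseteq> reduced_pairs a (l / 2) V" "card R = N"
      by (rule obtain_subset_with_card_n)
    define Q where "Q = (\<lambda>p B. finite B \<and> card B = m V \<and> B \<subseteq> {0..t V} \<and>
        (\<forall>b\<in>B. \<forall>c\<in>B. b < c \<longrightarrow> g V \<le> c - b) \<and>
        (\<forall>b\<in>B. {real (snd p) / real (fst p) + b .. real (snd p) / real (fst p) + b + l' V} \<inter> {..1} \<subseteq> E n))"
    have "\<forall>p\<in>R. \<exists>B. Q p B"
    proof
      fix p :: "nat \<times> nat" assume p: "p \<in> R"
      show "\<exists>B. Q p B" unfolding Q_def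
      proof (rule nr)
        have "(a + l / 2) * real (fst p) \<le> 1 * real (fst p)" using a l by (intro mult_right_mono) auto
        moreover have "real (snd p) \<le> (a + l / 2) * real (fst p)"
          using subsetD[OF R(1) p] by (auto simp: reduced_pairs_def frac_pairs_def)
        ultimately show "snd p \<le> fst p" by simp
      qed (use subsetD[OF R(1) p] in \<open>auto simp: reduced_pairs_def frac_pairs_def\<close>)
    qed
    from bchoice[OF this] obtain B where Q: "\<forall>p\<in>R. Q p (B p)" ..
    have B: "finite (B p)" "card (B p) = m V" "B p \<subseteq> {0..t V}"
      "\<And>b c. b \<in> B p \<Longrightarrow> c \<in> B p \<Longrightarrow> b < c \<Longrightarrow> g V \<le> c - b"
      "\<And>b. b \<in> B p \<Longrightarrow>
        {real (snd p) / real (fst p) + b .. real (snd p) / real (fst p) + b + l' V} \<inter> {..1} \<subseteq> E n"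
      if "p \<in> R" for p
      using bspec[OF Q that] unfolding Q_def by blast+
    define Y where "Y = (\<lambda>(p, b). real (snd p) / real (fst p) + b) ` (SIGMA p:R. B p)"
    have "card Y = card R * m V" and spr: "spread 96 s a l (l' V) Y"
      unfolding Y_def
      using spread_around_reduced_fractions[of s l a V R "l' V" "t V" "g V" B "m V"] s l a V R N sz B sc1
      by (simp_all add: order_trans[OF sz(3) V(2)])
    moreover have "{y..y + l' V} \<subseteq> E n" if y: "y \<in> Y" for y
    proof -
      obtain p b where pb: "p \<in> R" "b \<in> B p" "y = real (snd p) / real (fst p) + b"
        using y by (auto simp: Y_def)
      have "y + l' V \<le> 1" using spr y a by (force simp: spread_def)
      then show ?thesis using B(5)[OF pb(1,2)] unfolding pb(3) by auto
    qed
    ultimately show ?thesis using R(2) by blast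
  qed
  have "l' V \<le> l / 2" using sz(2,3) V(2) by linarith
  then show "\<exists>l' m. 0 < l' \<and> l' \<le> l / 2 \<and> 1 \<le> real m * l' powr s \<and>
        (\<forall>a. 0 \<le> a \<and> a + l \<le> 1 \<longrightarrow>
          (\<exists>Y. spread 96 s a l l' Y \<and> card Y = m \<and> (\<forall>y\<in>Y. {y..y+l'} \<subseteq> E n)))"
    using sz(1) mass tree by blast
qed simp

section \<open>Special points close to the curve\<close>

definition special_approx :: "real \<Rightarrow> real \<Rightarrow> int \<times> int \<times> int \<times> int \<Rightarrow> bool" where
  "special_approx lam \<xi> = (\<lambda>(p0, p1, p2, p3). special (p0, p1, p2, p3) \<and> 0 < p0 \<and>
     \<bar>of_int p0 * \<xi> - of_int p1\<bar> < of_int p0 powr (- lam) \<and>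
     \<bar>of_int p0 * \<xi>^2 - of_int p2\<bar> < of_int p0 powr (- lam) \<and>
     \<bar>of_int p0 * \<xi>^3 - of_int p3\<bar> < of_int p0 powr (- lam))"

lemma S_s_altdef: "S_s lam = {\<xi>. infinite {p. special_approx lam \<xi> p}}"
proof -
  have "{(p0, p1, p2, p3). special (p0, p1, p2, p3) \<and> 0 < p0 \<and>
     Max {abs (of_int p0 * \<xi> - of_int p1), abs (of_int p0 * \<xi>^2 - of_int p2),
          abs (of_int p0 * \<xi>^3 - of_int p3)} < of_int p0 powr (- lam)} = {p. special_approx lam \<xi> p}" for \<xi> :: real
    by (auto simp: special_approx_def)
  then show ?thesis unfolding S_s_def by simp
qed

lemma mem_S_s_if_unbounded:
  assumes "\<And>n. \<exists>p. special_approx lam \<xi> p \<and> int n \<le> fst p"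
  shows "\<xi> \<in> S_s lam"
  unfolding S_s_altdef
proof (rule CollectI, rule notI)
  assume fin: "finite {p. special_approx lam \<xi> p}"
  define n where "n = Suc (nat (\<Sum>p\<in>{p. special_approx lam \<xi> p}. \<bar>fst p\<bar>))"
  obtain p where p: "special_approx lam \<xi> p" "int n \<le> fst p" using assms by blast
  have "\<bar>fst p\<bar> \<le> (\<Sum>p\<in>{p. special_approx lam \<xi> p}. \<bar>fst p\<bar>)"
    by (rule member_le_sum[where f = "\<lambda>p. \<bar>fst p\<bar>"]) (use p fin in auto)
  then show False using p(2) unfolding n_def by linarith
qed

text \<open>
  For \<open>lam \<ge> 0\<close> the errors are at most 1, so each \<open>p\<^sub>0\<close> allows only finitely many \<open>p\<close>.
\<close>

lemma unbounded_if_mem_S_s: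
  assumes "0 \<le> lam" "\<xi> \<in> S_s lam"
  shows "\<exists>p. special_approx lam \<xi> p \<and> int n \<le> fst p"
proof (rule ccontr)
  assume no: "\<nexists>p. special_approx lam \<xi> p \<and> int n \<le> fst p"
  define M where "M = (\<lambda>i. \<lceil>real n * \<bar>\<xi>\<bar>^i + 1\<rceil>)"
  have bound: "\<bar>q\<bar> \<le> M i" if "\<bar>of_int p0 * \<xi>^i - of_int q\<bar> < of_int p0 powr (- lam)" "0 < p0" "p0 < int n"
    for p0 q i
  proof -
    have "of_int p0 powr (- lam) \<le> (1::real)" using that(2) assms(1)
      using powr_mono[of "-lam" 0 "of_int p0"] by simp
    then have "\<bar>of_int q\<bar> \<le> \<bar>of_int p0 * \<xi>^i\<bar> + 1" using that(1) by linarith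
    also have "\<bar>of_int p0 * \<xi>^i\<bar> = of_int p0 * \<bar>\<xi>\<bar>^i" using that(2) by (simp add: abs_mult power_abs)
    also have "\<dots> \<le> real n * \<bar>\<xi>\<bar>^i" using that(3) by (intro mult_right_mono) auto
    finally show ?thesis unfolding M_def by linarith
  qed
  have "{p. special_approx lam \<xi> p} \<subseteq> {0..int n} \<times> {- M 1..M 1} \<times> {- M 2..M 2} \<times> {- M 3..M 3}"
  proof
    fix p assume "p \<in> {p. special_approx lam \<xi> p}"
    then obtain p0 p1 p2 p3 where pp: "p = (p0, p1, p2, p3)" and p: "special_approx lam \<xi> (p0, p1, p2, p3)"
      by (cases p) auto
    then have p0: "0 < p0" "p0 < int n" using no by (auto simp: special_approx_def not_le)
    have "\<bar>p1\<bar> \<le> M 1" "\<bar>p2\<bar> \<le> M 2" "\<bar>p3\<bar> \<le> M 3"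
      by (rule bound[OF _ p0]; use p in \<open>simp add: special_approx_def\<close>)+
    then show "p \<in> {0..int n} \<times> {- M 1..M 1} \<times> {- M 2..M 2} \<times> {- M 3..M 3}"
      using p0 by (auto simp: pp)
  qed
  then have "finite {p. special_approx lam \<xi> p}" by (rule finite_subset) auto
  then show False using assms(2) by (simp add: S_s_altdef)
qed

text \<open>
  The special point is a multiple of \<open>\<gamma>(u/v)\<close> with integer coordinates. For \<open>i \<le> 3\<close> and
  points of the unit interval, \<open>\<xi>\<^sup>i - r\<^sup>i\<close> is at most \<open>3 (\<xi> - r)\<close>.
\<close>

lemma special_approx_rational:
  fixes u v :: nat
  assumes uv: "coprime u v" "0 < v" "u \<le> v" and xi: "real u / real v \<le> \<xi>" "\<xi> \<le> 1"
    and close: "3 * real v ^ 3 * (\<xi> - real u / real v) < (real v ^ 3) powr (- lam)"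
  shows "special_approx lam \<xi> (int v ^ 3, int v ^ 2 * int u, int v * int u ^ 2, int u ^ 3)"
proof -
  define r where "r = real u / real v"
  have u: "real u = real v * r" using uv by (simp add: r_def)
  have r: "0 \<le> r" "r \<le> 1" using uv by (auto simp: r_def)
  have "(of_int (int v ^ 3), of_int (int v ^ 2 * int u), of_int (int v * int u ^ 2), of_int (int u ^ 3))
      \<in> L_square (int u) (int v)"
    by (simp add: L_square_def power2_eq_square power3_eq_cube algebra_simps)
  then have "special (int v ^ 3, int v ^ 2 * int u, int v * int u ^ 2, int u ^ 3)"
    unfolding special_def prod.case using uv(1)
    by (intro exI[where x = "int u"] exI[where x = "int v"] conjI) simp_all
  moreover have main: "\<bar>real v ^ 3 * \<xi> ^ i - w\<bar> < (real v ^ 3) powr (- lam)"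
    if "real v ^ 3 * \<xi> ^ i - w = real v ^ 3 * (\<xi> - r) * F" "0 \<le> F" "F \<le> 3" for i w F
  proof -
    have "real v ^ 3 * (\<xi> - r) * F \<le> real v ^ 3 * (\<xi> - r) * 3"
      using xi that by (intro mult_left_mono mult_nonneg_nonneg) (auto simp: r_def)
    moreover have "0 \<le> real v ^ 3 * (\<xi> - r) * F"
      using xi that by (intro mult_nonneg_nonneg) (auto simp: r_def)
    ultimately show ?thesis using close that(1) by (simp add: r_def mult_ac)
  qed
  moreover have x: "r \<le> \<xi>" "0 \<le> \<xi>" using xi(1)[folded r_def] r by linarith+
  have "\<bar>real v ^ 3 * \<xi> ^ 1 - real v ^ 2 * real u\<bar> < (real v ^ 3) powr (- lam)"
    by (rule main[of _ _ 1]) (auto simp: u power2_eq_square power3_eq_cube algebra_simps)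
  moreover have "\<bar>real v ^ 3 * \<xi> ^ 2 - real v * real u ^ 2\<bar> < (real v ^ 3) powr (- lam)"
    by (rule main[of _ _ "\<xi> + r"])
      (use x r xi in \<open>auto simp: u power2_eq_square power3_eq_cube algebra_simps\<close>)
  moreover have "\<bar>real v ^ 3 * \<xi> ^ 3 - real u ^ 3\<bar> < (real v ^ 3) powr (- lam)"
  proof (rule main[of _ _ "\<xi> * \<xi> + \<xi> * r + r * r"])
    have "\<xi> * \<xi> \<le> 1" "\<xi> * r \<le> 1" "r * r \<le> 1" using x r xi by (auto intro: mult_le_one)
    then show "\<xi> * \<xi> + \<xi> * r + r * r \<le> 3" by linarith
  qed (use x r xi in \<open>auto simp: u power2_eq_square power3_eq_cube algebra_simps\<close>)
  ultimately show ?thesis using uv by (simp add: special_approx_def)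
qed

text \<open>
  Here \<open>p = p\<^sub>0 (\<gamma>(r) + \<eta> \<gamma>'(r))\<close> with \<open>r = u/v\<close>, \<open>p\<^sub>0 = v\<^sup>2 q\<close> and \<open>\<eta> = 1/(v q)\<close>. Its last coordinate is \<open>u\<^sup>2 (u q + 3)/v\<close>, which is
  why \<open>v\<close> has to divide \<open>u q + 3\<close>. The error consists of the second
  order Taylor term, bounded by \<open>4 \<eta>\<^sup>2\<close>, and of the displacement \<open>\<theta>\<close>.
\<close>

lemma special_approx_tangent:
  fixes u v q :: nat
  defines "\<eta> \<equiv> 1 / (real v * real q)"
  assumes uv: "coprime u v" "0 < v" "u \<le> v" and q: "0 < q" "v dvd u * q + 3"
    and xi: "real u / real v + \<eta> \<le> \<xi>" "\<xi> \<le> real u / real v + \<eta> + \<theta>" "\<xi> \<le> 1"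
    and close: "real v ^ 2 * real q * (4 * \<eta>\<^sup>2 + 3 * \<theta>) < (real v ^ 2 * real q) powr (- lam)"
  shows "special_approx lam \<xi> (int v ^ 2 * int q, int v * (int u * int q + 1),
      int u ^ 2 * int q + 2 * int u, int u ^ 2 * int ((u * q + 3) div v))"
proof -
  define r where "r = real u / real v"
  define x where "x = r + \<eta>"
  define p0 where "p0 = real v ^ 2 * real q"
  define w where "w = (u * q + 3) div v"
  have w: "w * v = u * q + 3" using q(2) by (simp add: w_def)
  then have wr: "real w * real v = real u * real q + 3" by (metis of_nat_add of_nat_mult of_nat_numeral)
  have u: "real u = real v * r" using uv by (simp add: r_def)
  have w': "real w = r * real q + 3 / real v"
    using wr uv by (simp add: u field_simps)
  have eta: "real v * real q * \<eta> = 1" using uv q by (simp add: \<eta>_def)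
  have r: "0 \<le> r" "r \<le> 1" using uv by (auto simp: r_def)
  have "0 < real v * real q" "1 \<le> v * q" using uv q by (simp_all add: Suc_leI)
  then have eta01: "0 \<le> \<eta>" "\<eta> \<le> 1" unfolding \<eta>_def
    by (auto simp: divide_le_eq_1 simp flip: of_nat_mult)
  have xxi: "x \<le> \<xi>" "\<xi> \<le> x + \<theta>" using xi by (auto simp: x_def r_def)
  have x01: "0 \<le> x" "x \<le> 1" using xxi xi r eta01 by (auto simp: x_def)
  have p0: "0 < p0" using uv q by (simp add: p0_def)
  have p0eta: "p0 * \<eta> = real v" using eta by (simp add: p0_def power2_eq_square)
  define p1 p2 p3 where "p1 = real v * (real u * real q + 1)"
    and "p2 = real u ^ 2 * real q + 2 * real u" and "p3 = real u ^ 2 * real w"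
  have P1: "p1 = p0 * (r + \<eta>)" and P2: "p2 = p0 * (r\<^sup>2 + 2 * r * \<eta>)" and P3: "p3 = p0 * (r ^ 3 + 3 * r\<^sup>2 * \<eta>)"
  proof -
    have "p0 * (r + \<eta>) = p0 * r + p0 * \<eta>" by (simp add: algebra_simps)
    then show "p1 = p0 * (r + \<eta>)" unfolding p0eta by (simp add: p0_def p1_def u power2_eq_square algebra_simps)
    have "p0 * (r\<^sup>2 + 2 * r * \<eta>) = p0 * r\<^sup>2 + 2 * r * (p0 * \<eta>)" by (simp add: algebra_simps)
    then show "p2 = p0 * (r\<^sup>2 + 2 * r * \<eta>)" unfolding p0eta
      by (simp add: p0_def p2_def u power2_eq_square algebra_simps)
    have "p0 * (r ^ 3 + 3 * r\<^sup>2 * \<eta>) = p0 * r ^ 3 + 3 * r\<^sup>2 * (p0 * \<eta>)" by (simp add: algebra_simps)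
    then show "p3 = p0 * (r ^ 3 + 3 * r\<^sup>2 * \<eta>)" unfolding p0eta
      using uv by (simp add: p0_def p3_def u w' power2_eq_square power3_eq_cube field_simps)
  qed
  have "(of_int (int v ^ 2 * int q), of_int (int v * (int u * int q + 1)),
      of_int (int u ^ 2 * int q + 2 * int u), of_int (int u ^ 2 * int w)) \<in> L_square (int u) (int v)"
  proof -
    have "real v ^ 2 * p3 = 2 * real u * real v * p2 - real u ^ 2 * p1"
      unfolding p1_def p2_def p3_def using wr by algebra
    then show ?thesis unfolding p1_def p2_def p3_def
      by (simp add: L_square_def power2_eq_square algebra_simps)
  qed
  then have "special (int v ^ 2 * int q, int v * (int u * int q + 1),
      int u ^ 2 * int q + 2 * int u, int u ^ 2 * int w)"
    unfolding special_def prod.case using uv(1)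
    by (intro exI[where x = "int u"] exI[where x = "int v"] conjI) simp_all
  moreover have main: "\<bar>p0 * \<xi> ^ i - p\<bar> < p0 powr (- lam)"
    if "p0 * \<xi> ^ i - p = p0 * (F + (\<xi> - x) * G)" "0 \<le> F" "F \<le> 4 * \<eta>\<^sup>2" "0 \<le> G" "G \<le> 3" for i p F G
  proof -
    have "(\<xi> - x) * G \<le> \<theta> * 3" using xxi that by (intro mult_mono) auto
    then have "p0 * (F + (\<xi> - x) * G) \<le> p0 * (4 * \<eta>\<^sup>2 + 3 * \<theta>)"
      using p0 that by (intro mult_left_mono) auto
    moreover have "0 \<le> p0 * (F + (\<xi> - x) * G)"
      using p0 that xxi by (intro mult_nonneg_nonneg add_nonneg_nonneg) auto
    ultimately show ?thesis using close that(1) unfolding p0_def[symmetric] by simp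
  qed
  moreover have "\<bar>p0 * \<xi> ^ 1 - p1\<bar> < p0 powr (- lam)"
    by (rule main[of _ _ 0 1]) (auto simp: P1 x_def algebra_simps)
  moreover have "\<bar>p0 * \<xi> ^ 2 - p2\<bar> < p0 powr (- lam)"
    by (rule main[of _ _ "\<eta>\<^sup>2" "\<xi> + x"])
      (use xxi x01 xi(3) in \<open>auto simp: P2 x_def power2_eq_square algebra_simps\<close>)
  moreover have "\<bar>p0 * \<xi> ^ 3 - p3\<bar> < p0 powr (- lam)"
  proof (rule main[of _ _ "3 * r * \<eta>\<^sup>2 + \<eta> * \<eta>\<^sup>2" "\<xi> * \<xi> + \<xi> * x + x * x"])
    have "\<xi> * \<xi> \<le> 1" "\<xi> * x \<le> 1" "x * x \<le> 1" using xxi x01 xi(3) by (auto intro: mult_le_one)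
    then show "\<xi> * \<xi> + \<xi> * x + x * x \<le> 3" by linarith
    have "3 * r * \<eta>\<^sup>2 \<le> 3 * \<eta>\<^sup>2" "\<eta> * \<eta>\<^sup>2 \<le> 1 * \<eta>\<^sup>2"
      using r eta01 by (intro mult_right_mono; simp)+
    then show "3 * r * \<eta>\<^sup>2 + \<eta> * \<eta>\<^sup>2 \<le> 4 * \<eta>\<^sup>2" by linarith
    show "p0 * \<xi> ^ 3 - p3 = p0 * (3 * r * \<eta>\<^sup>2 + \<eta> * \<eta>\<^sup>2 + (\<xi> - x) * (\<xi> * \<xi> + \<xi> * x + x * x))"
      by (simp add: P3 x_def power2_eq_square power3_eq_cube algebra_simps)
  qed (use xxi x01 r eta01 in auto)
  ultimately show ?thesis
    using uv q unfolding w_def[symmetric] p0_def p1_def p2_def p3_def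
    by (simp add: special_approx_def)
qed

section \<open>The lower bound from multiples of rational points\<close>

definition deep_approx :: "real \<Rightarrow> nat \<Rightarrow> real set" where
  "deep_approx lam n = {\<xi>. \<exists>p. special_approx lam \<xi> p \<and> int n \<le> fst p}"

lemma deep_approx_subset_S_s: "(\<Inter>n. deep_approx lam n) \<subseteq> S_s lam"
  by (auto simp: deep_approx_def intro!: mem_S_s_if_unbounded)

text \<open>
  The clusters are single points: near \<open>u/v\<close> one takes the whole interval of length \<open>V powr (-\<tau>)\<close>, with
  \<open>\<tau>\<close> slightly above \<open>3 (1 + lam)\<close> in order to absorb constants.
\<close>

lemma S_s_positive_measure_rational:
  fixes lam s :: real
  assumes lam: "0 \<le> lam" and s: "0 < s" "s < 2 / (3 * (1 + lam))"
  shows "hausdorff_measure s (S_s lam) \<noteq> 0"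
proof -
  have "3 * (1 + lam) < 2 / s" using s lam by (simp add: field_simps)
  then obtain \<tau> where \<tau>: "3 * (1 + lam) < \<tau>" "\<tau> < 2 / s" using dense by blast
  have \<tau>3: "3 < \<tau>" using \<tau>(1) lam by (simp add: distrib_left)
  have \<tau>s: "0 < 2 - \<tau> * s" using \<tau>(2) s(1) by (simp add: pos_less_divide_eq)
  have "s < 1"
  proof -
    have "2 / (3 * (1 + lam)) < 1" using lam by simp
    then show ?thesis using s by linarith
  qed
  show ?thesis
  proof (rule positive_measure_near_reduced_fractions[where E = "deep_approx lam" and m = "\<lambda>_. 1" and l' = "\<lambda>V. real V powr (- \<tau>)"
        and g = "\<lambda>_. 1" and t = "\<lambda>_. 0", OF s(1) _ _ _ _ deep_approx_subset_S_s])
    have "\<forall>\<^sub>F V::nat in sequentially. 0 < real V powr (- \<tau>)" "\<forall>\<^sub>F V::nat in sequentially. real V powr (- \<tau>) < 1"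
      "\<forall>\<^sub>F V::nat in sequentially. real V powr (- \<tau>) \<le> 1 / (2 * real V ^ 2)"
      using \<tau>3 by real_asymp+
    then show "\<forall>\<^sub>F V in sequentially. 0 < real V powr (- \<tau>) \<and> 0 \<le> (0::real) \<and>
        0 + real V powr (- \<tau>) \<le> 1 / (2 * real V ^ 2) \<and> real V powr (- \<tau>) < 1 \<and> 0 < (1::nat)"
      by eventually_elim simp
  next
    fix K :: real assume K: "0 < K"
    have "\<forall>\<^sub>F V::nat in sequentially. K \<le> real V powr (2 - \<tau> * s)" using \<tau>s by real_asymp
    moreover have "\<forall>\<^sub>F V::nat in sequentially. 0 < V" by (rule eventually_gt_at_top)
    ultimately show "\<forall>\<^sub>F V in sequentially. \<forall>d. real V powr (- \<tau>) \<le> d \<and> d \<le> 1 / real V ^ 2 \<longrightarrow>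
        K * min (real 1) (2 * d / 1 + 1) \<le> real V ^ 2 * real 1 * d powr s"
    proof eventually_elim
      case (elim V)
      show ?case
      proof (intro allI impI)
        fix d assume d: "real V powr (- \<tau>) \<le> d \<and> d \<le> 1 / real V ^ 2"
        have "K * min (real 1) (2 * d / 1 + 1) \<le> K * 1" using K by (intro mult_left_mono) auto
        also have "\<dots> \<le> real V powr 2 * (real V powr (- \<tau>)) powr s"
          using elim(1) by (subst powr_powr, subst powr_add[symmetric]) simp
        also have "\<dots> \<le> real V powr 2 * d powr s"
          using d s by (intro mult_left_mono powr_mono2) auto
        finally show "K * min (real 1) (2 * d / 1 + 1) \<le> real V ^ 2 * real 1 * d powr s"
          using elim by simp
      qed
    qed
  next
    fix n
    have "\<forall>\<^sub>F V::nat in sequentially. 3 * real V powr (3 - \<tau>) < real V powr (- 3 * lam)"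
      using \<tau> lam by real_asymp
    moreover have "\<forall>\<^sub>F V::nat in sequentially. 4 * n < V" by (rule eventually_gt_at_top)
    ultimately show "\<forall>\<^sub>F V in sequentially. \<forall>u v. coprime u v \<and> V < 4 * v \<and> v \<le> V \<and> u \<le> v \<longrightarrow>
        (\<exists>B. finite B \<and> card B = 1 \<and> B \<subseteq> {0..0::real} \<and> (\<forall>b\<in>B. \<forall>c\<in>B. b < c \<longrightarrow> 1 \<le> c - b) \<and>
          (\<forall>b\<in>B. {real u / real v + b .. real u / real v + b + real V powr (- \<tau>)} \<inter> {..1} \<subseteq> deep_approx lam n))"
    proof eventually_elim
      case (elim V)
      have "\<xi> \<in> deep_approx lam n"
        if uv: "coprime u v" "V < 4 * v" "v \<le> V" "u \<le> v"
          and xi: "real u / real v \<le> \<xi>" "\<xi> \<le> real u / real v + real V powr (- \<tau>)" "\<xi> \<le> 1" for u v \<xi>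
      proof -
        have v0: "0 < v" and nv: "n \<le> v" using uv elim by linarith+
        have "3 * real v ^ 3 * (\<xi> - real u / real v) \<le> 3 * real V ^ 3 * real V powr (- \<tau>)"
          using uv xi by (intro mult_mono power_mono) auto
        also have "\<dots> = 3 * real V powr (3 - \<tau>)" using elim uv v0
          by (simp add: powr_diff powr_minus divide_inverse)
        also have "\<dots> < real V powr (- 3 * lam)" by (rule elim)
        also have "\<dots> \<le> real v powr (- 3 * lam)"
          using uv v0 lam by (intro powr_mono2') auto
        also have "\<dots> = (real v ^ 3) powr (- lam)"
          using v0 by (simp add: powr_powr flip: powr_numeral)
        finally have "special_approx lam \<xi> (int v ^ 3, int v ^ 2 * int u, int v * int u ^ 2, int u ^ 3)"
          by (intro special_approx_rational uv v0 xi)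
        moreover have "int n \<le> int v ^ 3"
        proof -
          have "int v ^ 1 \<le> int v ^ 3" using v0 by (intro power_increasing) auto
          then show ?thesis using nv by simp
        qed
        ultimately show ?thesis
          unfolding deep_approx_def by (intro CollectI exI conjI) (assumption, simp)
      qed
      then show ?case by (intro allI impI exI[of _ "{0}"]) auto
    qed
  qed (use \<open>s < 1\<close> in auto)
qed

section \<open>The lower bound from points on tangent lines\<close>

text \<open>
  The condition \<open>v dvd u q + 3\<close> selects a residue class modulo \<open>v\<close>; its members between
  \<open>Q\<close> and \<open>2 Q\<close> are \<open>v\<close> apart, so their reciprocals, divided by \<open>v\<close>, are at least \<open>1 / (2 Q)\<^sup>2\<close> apart.
\<close>

lemma reciprocal_progression:
  fixes u v :: nat and Q :: real
  assumes uv: "coprime u v" "0 < v" and Q: "1 \<le> Q" "real m * real v \<le> Q"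
  defines "f \<equiv> (\<lambda>q::nat. 1 / (real v * real q))"
  obtains q0 where "\<And>j. j < m \<Longrightarrow> v dvd u * (q0 + j * v) + 3"
    "\<And>j. j < m \<Longrightarrow> Q \<le> real (q0 + j * v)" "\<And>j. j < m \<Longrightarrow> real (q0 + j * v) \<le> 2 * Q"
    "\<And>i j. i < j \<Longrightarrow> j < m \<Longrightarrow> 1 / (4 * Q\<^sup>2) \<le> f (q0 + i * v) - f (q0 + j * v)"
proof -
  obtain c where c: "v dvd u * c + 3"
  proof -
    \<comment> \<open>Modulo \<open>v\<close> the factor \<open>3 (v - 1)\<close> is \<open>-3\<close>.\<close>
    obtain x y where "int u * x + int v * y = 1"
      using bezout_int[of "int u" "int v"] uv(1) by (auto simp: mult.commute)
    then have "int u * (3 * (int v - 1) * x) + 3 = int v * (3 - 3 * (int v - 1) * y)"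
      by algebra
    then have 1: "int v dvd int u * (3 * (int v - 1) * x) + 3" by simp
    define c where "c = nat ((3 * (int v - 1) * x) mod int v)"
    have c: "int c = (3 * (int v - 1) * x) mod int v" using uv(2) by (simp add: c_def)
    have "(int u * int c + 3) mod int v = (int u * (3 * (int v - 1) * x) + 3) mod int v"
      unfolding c by (metis mod_add_left_eq mod_mult_right_eq)
    then have "int v dvd int (u * c + 3)" using 1 by (simp add: dvd_eq_mod_eq_0)
    then have "v dvd u * c + 3" by (simp only: int_dvd_int_iff)
    then show ?thesis by (rule that)
  qed
  define k where "k = \<lceil>(Q - real c) / real v\<rceil>"
  define q0 where "q0 = nat (int c + int v * k)"
  have k: "(Q - real c) / real v \<le> of_int k" "of_int k < (Q - real c) / real v + 1"
    unfolding k_def by linarith+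
  have lo: "Q \<le> real_of_int (int c + int v * k)" using k(1) uv(2) by (simp add: field_simps)
  have hi: "real_of_int (int c + int v * k) < Q + real v" using k(2) uv(2) by (simp add: field_simps)
  have "0 \<le> real_of_int (int c + int v * k)" using lo Q by linarith
  then have q0: "int q0 = int c + int v * k" unfolding q0_def by (simp only: of_int_0_le_iff nat_0_le)
  have q0': "real q0 = real_of_int (int c + int v * k)" using q0 by (metis of_int_of_nat_eq)
  show ?thesis
  proof (rule that[of q0])
    fix j assume j: "j < m"
    have "int (u * (q0 + j * v) + 3) = int (u * c + 3) + int v * (int u * (k + int j))"
      by (simp add: q0 algebra_simps)
    moreover have "int v dvd int (u * c + 3)" using c by (simp only: int_dvd_int_iff)
    ultimately have "int v dvd int (u * (q0 + j * v) + 3)" by (metis dvd_add dvd_triv_left)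
    then show "v dvd u * (q0 + j * v) + 3" by (simp only: int_dvd_int_iff)
    show "Q \<le> real (q0 + j * v)" by (rule order_trans[OF lo]) (simp add: q0')
    have "real (Suc j) * real v \<le> real m * real v" using j by (intro mult_right_mono) auto
    then show "real (q0 + j * v) \<le> 2 * Q" using hi q0' Q by (simp add: algebra_simps)
  next
    fix i j assume ij: "i < j" "j < m"
    define x y where "x = real (q0 + i * v)" and "y = real (q0 + j * v)"
    have "real (Suc j) * real v \<le> real m * real v" using ij by (intro mult_right_mono) auto
    then have y2: "y \<le> 2 * Q" using hi q0' Q by (simp add: y_def algebra_simps)
    have xQ: "Q \<le> x" by (rule order_trans[OF lo]) (simp add: x_def q0')
    have "real (Suc i) * real v \<le> real j * real v" using ij by (intro mult_right_mono) auto
    then have xy: "x + real v \<le> y" by (simp add: x_def y_def algebra_simps)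
    have pos: "0 < x" "0 < y" "0 < real v" using xQ xy Q uv(2) by auto
    have "1 / (4 * Q\<^sup>2) \<le> 1 / (x * y)"
    proof (rule divide_left_mono)
      have "x * y \<le> (2 * Q) * (2 * Q)" using xy y2 pos by (intro mult_mono) auto
      then show "x * y \<le> 4 * Q\<^sup>2" by (simp add: power2_eq_square)
    qed (use pos Q in auto)
    also have "\<dots> \<le> (y - x) / (real v * (x * y))"
    proof -
      have "1 / (x * y) = real v / (real v * (x * y))" using pos by simp
      also have "\<dots> \<le> (y - x) / (real v * (x * y))" using xy pos by (intro divide_right_mono) auto
      finally show ?thesis .
    qed
    also have "\<dots> = f (q0 + i * v) - f (q0 + j * v)"
      unfolding f_def x_def[symmetric] y_def[symmetric] using pos by (simp add: field_simps)
    finally show "1 / (4 * Q\<^sup>2) \<le> f (q0 + i * v) - f (q0 + j * v)" .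
  qed
qed

text \<open>
  Room for the exponents used below: \<open>V powr (\<tau>-1)\<close> is the size of \<open>q\<close>, and \<open>V powr (-\<rho>)\<close> the length of the smallest
  intervals. The bounds from below make the points good approximations, and those from above keep the
  Cantor set spread out in dimension \<open>s\<close>. They are compatible because \<open>s < 1/2\<close>, and this is
  where \<open>lam \<ge> 3/5\<close> enters.
\<close>

lemma tangent_exponents_exist:
  fixes lam s :: real
  assumes lam: "3 / 5 \<le> lam" "lam < 1" and s: "0 < s" "s < (2 - 2 * lam) / (1 + lam)"
  obtains \<tau> \<rho> where "(1 + lam) / (1 - lam) < \<tau>" "\<tau> * s < 2" "(1 + \<tau>) * (1 + lam) < \<rho>"
    "2 * \<tau> < \<rho>" "\<rho> * s < \<tau>" "s < 1 / 2" "4 < \<tau>"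
proof -
  have "(1 + lam) / (1 - lam) < 2 / s" using s lam by (simp add: field_simps)
  then obtain \<tau> where \<tau>: "(1 + lam) / (1 - lam) < \<tau>" "\<tau> < 2 / s" using dense by blast
  have \<tau>1: "1 + lam < \<tau> * (1 - lam)" using \<tau>(1) lam by (simp add: pos_divide_less_eq)
  have "(2 - 2 * lam) / (1 + lam) \<le> 1 / 2" using lam by (simp add: field_simps)
  then have s2: "s < 1 / 2" using s by linarith
  have "4 * (1 - lam) \<le> 1 + lam" using lam by simp
  then have "4 * (1 - lam) < \<tau> * (1 - lam)" using \<tau>1 by (rule le_less_trans)
  then have \<tau>4: "4 < \<tau>" by (rule mult_right_less_imp_less) (use lam in simp)
  have \<tau>s: "\<tau> / s > 2 * \<tau>"
  proof -
    have "s * (2 * \<tau>) < 1 / 2 * (2 * \<tau>)" using s2 \<tau>4 by (intro mult_strict_right_mono) auto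
    then show ?thesis using s by (simp add: pos_less_divide_eq mult_ac)
  qed
  moreover have "(1 + \<tau>) * (1 + lam) < \<tau> / s"
  proof -
    \<comment> \<open>The lower bound on \<open>\<tau>\<close> says exactly that \<open>(1 + \<tau>) (1 + lam) < 2 \<tau>\<close>.\<close>
    have "(1 + \<tau>) * (1 + lam) < 2 * \<tau>" using \<tau>1 by (simp add: algebra_simps)
    then show ?thesis using \<tau>s by linarith
  qed
  ultimately have "max (2 * \<tau>) ((1 + \<tau>) * (1 + lam)) < \<tau> / s" by simp
  then obtain \<rho> where "max (2 * \<tau>) ((1 + \<tau>) * (1 + lam)) < \<rho>" "\<rho> < \<tau> / s" using dense by blast
  then show ?thesis using \<tau> s s2 \<tau>4 by (intro that[of \<tau> \<rho>]) (auto simp: pos_less_divide_eq)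
qed

text \<open>
  The cluster near \<open>u/v\<close> consists of the points \<open>u/v + 1/(v q)\<close> with \<open>q\<close> in the progression of
  \<open>reciprocal_progression\<close> for \<open>Q = V powr (\<tau>-1)\<close>. The two terms of \<open>close\<close> bound
  \<open>p\<^sub>0 powr (1+lam)\<close> times the Taylor term and times the interval length.
\<close>

lemma tangent_fractions_near:
  fixes lam \<tau> \<rho> :: real and u v V :: nat
  assumes lam: "0 \<le> lam" "lam < 1" and \<tau>: "2 \<le> \<tau>"
    and V: "n \<le> v" "V < 4 * v" "v \<le> V" and uv: "coprime u v" "u \<le> v"
    and m: "m = nat \<lfloor>real V powr (\<tau> - 2)\<rfloor>"
    and close: "4 * (real V powr (2 * lam) * real V powr ((\<tau> - 1) * (lam - 1))) +
      3 * ((2 * real V powr (1 + \<tau>)) powr (1 + lam) * real V powr (- \<rho>)) < 1"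
  shows "\<exists>B. finite B \<and> card B = m \<and> B \<subseteq> {0..4 * real V powr (- \<tau>)} \<and>
      (\<forall>b\<in>B. \<forall>c\<in>B. b < c \<longrightarrow> 1 / (4 * (real V powr (\<tau> - 1))\<^sup>2) \<le> c - b) \<and>
      (\<forall>b\<in>B. {real u / real v + b .. real u / real v + b + real V powr (- \<rho>)} \<inter> {..1} \<subseteq> deep_approx lam n)"
proof -
  define Q where "Q = real V powr (\<tau> - 1)"
  define f where "f = (\<lambda>q::nat. 1 / (real v * real q))"
  have v0: "0 < v" and V0: "0 < V" using V by auto
  have Q1: "1 \<le> Q" unfolding Q_def using V0 \<tau> by (intro ge_one_powr_ge_zero) auto
  have VQ: "real V * Q = real V powr \<tau>" using V0 by (simp add: Q_def powr_diff)
  have "real m * real v \<le> real V powr (\<tau> - 2) * real V"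
    using V unfolding m by (intro mult_mono) auto
  also have "\<dots> = Q" using V0 by (simp add: Q_def powr_diff power2_eq_square)
  finally have mQ: "real m * real v \<le> Q" .
  obtain q0 where q: "\<And>j. j < m \<Longrightarrow> v dvd u * (q0 + j * v) + 3"
    "\<And>j. j < m \<Longrightarrow> Q \<le> real (q0 + j * v)" "\<And>j. j < m \<Longrightarrow> real (q0 + j * v) \<le> 2 * Q"
    and gap: "\<And>i j. i < j \<Longrightarrow> j < m \<Longrightarrow> 1 / (4 * Q\<^sup>2) \<le> f (q0 + i * v) - f (q0 + j * v)"
    using reciprocal_progression[OF uv(1) v0 Q1 mQ] unfolding f_def by blast
  define b where "b = (\<lambda>j. f (q0 + j * v))"
  have gap0: "0 < 1 / (4 * Q\<^sup>2)" using Q1 by simp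
  have bless: "b j < b i" if "i < j" "j < m" for i j using less_le_trans[OF gap0 gap[OF that]] by (simp add: b_def)
  have inj: "inj_on b {..<m}"
    by (rule linorder_inj_onI) (metis bless lessThan_iff less_irrefl, auto)
  have "b j \<le> 4 * real V powr (- \<tau>)" "0 \<le> b j" if "j < m" for j
  proof -
    have "real V * Q \<le> (4 * real v) * real (q0 + j * v)"
      using V q(2)[OF that] Q1 by (intro mult_mono) auto
    moreover have "0 < real V * Q" using V0 Q1 by simp
    ultimately have "1 / ((4 * real v) * real (q0 + j * v)) \<le> 1 / (real V * Q)"
      using le_imp_inverse_le by (simp only: inverse_eq_divide)
    then have "4 * (1 / ((4 * real v) * real (q0 + j * v))) \<le> 4 * (1 / (real V * Q))"
      by (rule mult_left_mono) simp
    moreover have "4 * (1 / ((4 * real v) * real (q0 + j * v))) = b j" by (simp add: b_def f_def)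
    moreover have "4 * (1 / (real V * Q)) = 4 * real V powr (- \<tau>)"
      unfolding VQ by (simp add: powr_minus_divide)
    ultimately show "b j \<le> 4 * real V powr (- \<tau>)" by simp
    show "0 \<le> b j" by (simp add: b_def f_def)
  qed
  then have range: "b ` {..<m} \<subseteq> {0..4 * real V powr (- \<tau>)}" by auto
  have sep: "1 / (4 * Q\<^sup>2) \<le> b i - b j" if "i < m" "j < m" "b j < b i" for i j
  proof -
    have "i < j" using bless[of j i] that by (metis less_asym less_irrefl linorder_neqE_nat)
    then show ?thesis using gap[of i j] that by (simp add: b_def)
  qed
  have "\<xi> \<in> deep_approx lam n"
    if j: "j < m" and xi: "real u / real v + b j \<le> \<xi>" "\<xi> \<le> real u / real v + b j + real V powr (- \<rho>)" "\<xi> \<le> 1" for j \<xi>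
  proof -
    define q where "q = q0 + j * v"
    have qQ: "Q \<le> real q" "real q \<le> 2 * Q" "v dvd u * q + 3" using q[OF j] by (simp_all add: q_def)
    have q0: "0 < real q" using qQ(1) Q1 by linarith
    define p0 where "p0 = real v ^ 2 * real q"
    define \<eta> where "\<eta> = 1 / (real v * real q)"
    have p0: "0 < p0" using v0 q0 by (simp add: p0_def)
    have "p0 powr (1 + lam) * \<eta>\<^sup>2 = real v powr (2 * lam) * real q powr (lam - 1)"
    proof -
      have p0pow: "p0 powr (1 + lam) = real v powr (2 * (1 + lam)) * real q powr (1 + lam)"
        using v0 q0 by (simp add: p0_def powr_mult powr_powr flip: powr_numeral)
      have eta2: "\<eta>\<^sup>2 = real v powr (- 2) * real q powr (- 2)"
        using v0 q0 by (simp add: \<eta>_def power_mult_distrib powr_minus divide_inverse power_inverse)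
      have "p0 powr (1 + lam) * \<eta>\<^sup>2 = (real v powr (2 * (1 + lam)) * real v powr (- 2)) *
          (real q powr (1 + lam) * real q powr (- 2))"
        unfolding p0pow eta2 by (simp only: mult_ac)
      also have "real v powr (2 * (1 + lam)) * real v powr (- 2) = real v powr (2 * lam)"
        by (simp flip: powr_add)
      also have "real q powr (1 + lam) * real q powr (- 2) = real q powr (lam - 1)"
        by (simp flip: powr_add)
      finally show ?thesis .
    qed
    also have "\<dots> \<le> real V powr (2 * lam) * Q powr (lam - 1)"
      using V v0 lam qQ Q1 by (intro mult_mono powr_mono2 powr_mono2') auto
    also have "Q powr (lam - 1) = real V powr ((\<tau> - 1) * (lam - 1))" by (simp add: Q_def powr_powr)
    finally have c1: "p0 powr (1 + lam) * \<eta>\<^sup>2 \<le> real V powr (2 * lam) * real V powr ((\<tau> - 1) * (lam - 1))" .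
    have "p0 \<le> real V ^ 2 * (2 * Q)"
      unfolding p0_def using V qQ by (intro mult_mono power_mono) auto
    also have "\<dots> = 2 * real V powr (1 + \<tau>)"
      using V0 by (simp add: Q_def powr_diff powr_add power2_eq_square)
    finally have "p0 powr (1 + lam) \<le> (2 * real V powr (1 + \<tau>)) powr (1 + lam)"
      using p0 lam by (intro powr_mono2) auto
    then have c2: "p0 powr (1 + lam) * real V powr (- \<rho>) \<le> (2 * real V powr (1 + \<tau>)) powr (1 + lam) * real V powr (- \<rho>)"
      by (intro mult_right_mono) auto
    have "p0 powr (1 + lam) * (4 * \<eta>\<^sup>2 + 3 * real V powr (- \<rho>)) < 1"
      using c1 c2 close by (simp add: algebra_simps)
    then have "p0 powr (- lam) * (p0 powr (1 + lam) * (4 * \<eta>\<^sup>2 + 3 * real V powr (- \<rho>))) < p0 powr (- lam) * 1"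
      using p0 by (intro mult_strict_left_mono) auto
    moreover have "p0 powr (- lam) * p0 powr (1 + lam) = p0" using p0 by (simp flip: powr_add)
    ultimately have "p0 * (4 * \<eta>\<^sup>2 + 3 * real V powr (- \<rho>)) < p0 powr (- lam)"
      by (metis mult.assoc mult.right_neutral)
    then have "special_approx lam \<xi> (int v ^ 2 * int q, int v * (int u * int q + 1),
      int u ^ 2 * int q + 2 * int u, int u ^ 2 * int ((u * q + 3) div v))"
      using xi q0 unfolding p0_def \<eta>_def b_def f_def q_def[symmetric]
      by (intro special_approx_tangent[where \<theta> = "real V powr (- \<rho>)"] uv v0 qQ(3)) auto
    moreover have "int n \<le> int v ^ 2 * int q"
    proof -
      have "int n * 1 \<le> int v ^ 2 * int q"
        using V(1) v0 q0 by (intro mult_mono) (auto intro: order_trans[OF _ self_le_power])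
      then show ?thesis by simp
    qed
    ultimately show ?thesis
      unfolding deep_approx_def by (intro CollectI exI conjI) (assumption, simp)
  qed
  then have deep: "\<forall>x\<in>b ` {..<m}. {real u / real v + x .. real u / real v + x + real V powr (- \<rho>)} \<inter> {..1} \<subseteq> deep_approx lam n"
    by auto
  show ?thesis
    using range sep deep by (intro exI[of _ "b ` {..<m}"]) (auto simp: card_image[OF inj] Q_def)
qed

text \<open>
  The left-hand side is compared with \<open>d powr s\<close> on both sides of \<open>d = V powr (-\<tau>)\<close>, the diameter of a
  cluster up to a constant. Above it the whole cluster is counted, which needs \<open>\<tau> s < 2\<close>. Below it the points of a cluster
  are counted by their gaps, which needs \<open>\<tau> s < 2\<close> again and, for the single point met at
  the smallest scale \<open>V powr (-\<rho>)\<close>, also \<open>\<rho> s < \<tau>\<close>.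
\<close>

lemma tangent_scale:
  fixes \<tau> \<rho> s K :: real
  assumes s: "0 < s" "s < 1" and \<tau>: "2 < \<tau>" "\<tau> * s < 2" "\<rho> * s < \<tau>" and K: "0 < K"
  shows "\<forall>\<^sub>F V in sequentially. \<forall>d. real V powr (- \<rho>) \<le> d \<and> d \<le> 1 / real V ^ 2 \<longrightarrow>
     K * min (real (nat \<lfloor>real V powr (\<tau> - 2)\<rfloor>)) (2 * d / (1 / (4 * (real V powr (\<tau> - 1))\<^sup>2)) + 1)
       \<le> real V ^ 2 * real (nat \<lfloor>real V powr (\<tau> - 2)\<rfloor>) * d powr s"
proof -
  have "\<forall>\<^sub>F V::nat in sequentially. 2 \<le> real V powr (\<tau> - 2)"
    "\<forall>\<^sub>F V::nat in sequentially. 32 * K \<le> real V powr (2 - \<tau> * s)"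
    "\<forall>\<^sub>F V::nat in sequentially. 4 * K \<le> real V powr (\<tau> - \<rho> * s)"
    using \<tau> by real_asymp+
  moreover have "\<forall>\<^sub>F V::nat in sequentially. 0 < V" by (rule eventually_gt_at_top)
  ultimately show ?thesis
  proof eventually_elim
    case (elim V)
    define X where "X = real V"
    have X0: "0 < X" using elim by (simp add: X_def)
    define m where "m = real (nat \<lfloor>X powr (\<tau> - 2)\<rfloor>)"
    have m: "X powr (\<tau> - 2) / 2 \<le> m" "m \<le> X powr (\<tau> - 2)"
      using elim(1) unfolding m_def X_def[symmetric] by linarith+
    have m0: "0 \<le> m" by (simp add: m_def)
    have X2m: "X powr \<tau> / 2 \<le> X\<^sup>2 * m"
      using mult_left_mono[OF m(1), of "X\<^sup>2"] X0 by (simp add: powr_diff)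
    have "K * min m (2 * d / (1 / (4 * (X powr (\<tau> - 1))\<^sup>2)) + 1) \<le> X\<^sup>2 * m * d powr s"
      if d: "X powr (- \<rho>) \<le> d" for d
    proof (cases "X powr (- \<tau>) \<le> d")
      case True
      have "K \<le> X powr (2 - \<tau> * s)" using elim(2) K by (simp add: X_def)
      also have "\<dots> = X powr 2 * (X powr (- \<tau>)) powr s"
        by (subst powr_powr, subst powr_add[symmetric]) simp
      also have "\<dots> \<le> X powr 2 * d powr s" using True s by (intro mult_left_mono powr_mono2) auto
      finally have "K * m \<le> (X\<^sup>2 * d powr s) * m" using X0 m0 by (intro mult_right_mono) auto
      moreover have "K * min m (2 * d / (1 / (4 * (X powr (\<tau> - 1))\<^sup>2)) + 1) \<le> K * m"
        using K by (intro mult_left_mono) auto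
      ultimately show ?thesis by (simp add: mult_ac)
    next
      case False
      have "0 < X powr (- \<rho>)" using X0 by simp
      then have d0: "0 < d" using d by (rule less_le_trans)
      have ds: "0 < d powr s" using d0 by simp
      have a: "2 * (K * (8 * d * (X powr (\<tau> - 1))\<^sup>2)) \<le> (X powr \<tau> / 2) * d powr s"
      proof -
        have "d powr (1 - s) \<le> (X powr (- \<tau>)) powr (1 - s)" using False d0 s by (intro powr_mono2) auto
        also have "\<dots> = X powr (\<tau> * s - \<tau>)" by (simp add: powr_powr algebra_simps)
        finally have 1: "d powr (1 - s) \<le> X powr (\<tau> * s - \<tau>)" .
        have "32 * K * d powr (1 - s) \<le> X powr (2 - \<tau> * s) * X powr (\<tau> * s - \<tau>)"
          using elim(2) 1 K by (intro mult_mono) (auto simp: X_def)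
        also have "\<dots> = X powr (2 - \<tau>)" by (simp flip: powr_add)
        finally have "X powr (2 * \<tau> - 2) * (32 * K * d powr (1 - s)) \<le> X powr (2 * \<tau> - 2) * X powr (2 - \<tau>)"
          by (intro mult_left_mono) auto
        also have "\<dots> = X powr \<tau>" by (simp flip: powr_add)
        finally have "X powr (2 * \<tau> - 2) * (32 * K * d powr (1 - s)) * d powr s \<le> X powr \<tau> * d powr s"
          using ds by (intro mult_right_mono) auto
        moreover have "d powr (1 - s) * d powr s = d" using d0 by (simp flip: powr_add)
        moreover have "(X powr (\<tau> - 1))\<^sup>2 = X powr (2 * \<tau> - 2)"
          by (simp add: power2_eq_square flip: powr_add)
        moreover have "X powr (2 * \<tau> - 2) * (32 * K * d powr (1 - s)) * d powr s
            = 32 * (K * ((d powr (1 - s) * d powr s) * X powr (2 * \<tau> - 2)))" by (simp add: mult_ac)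
        ultimately have "32 * (K * (d * (X powr (\<tau> - 1))\<^sup>2)) \<le> X powr \<tau> * d powr s" by metis
        then show ?thesis by (simp add: mult_ac)
      qed
      have b: "2 * K \<le> (X powr \<tau> / 2) * d powr s"
      proof -
        have "4 * K \<le> X powr (\<tau> - \<rho> * s)" using elim(3) by (simp add: X_def)
        also have "\<dots> = X powr \<tau> * (X powr (- \<rho>)) powr s"
          by (subst powr_powr, subst powr_add[symmetric]) simp
        also have "\<dots> \<le> X powr \<tau> * d powr s" using d s by (intro mult_left_mono powr_mono2) auto
        finally show ?thesis by simp
      qed
      have "K * min m (2 * d / (1 / (4 * (X powr (\<tau> - 1))\<^sup>2)) + 1)
          \<le> K * (2 * d / (1 / (4 * (X powr (\<tau> - 1))\<^sup>2)) + 1)"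
        using K by (intro mult_left_mono) auto
      also have "\<dots> = K * (8 * d * (X powr (\<tau> - 1))\<^sup>2) + K" by (simp add: algebra_simps)
      also have "\<dots> \<le> (X powr \<tau> / 2) * d powr s" using a b by linarith
      also have "\<dots> \<le> X\<^sup>2 * m * d powr s" using X2m ds by (intro mult_right_mono) auto
      finally show ?thesis .
    qed
    then show ?case by (simp add: X_def m_def)
  qed
qed

lemma S_s_positive_measure_tangent:
  fixes lam s :: real
  assumes lam: "3 / 5 \<le> lam" "lam < 1" and s: "0 < s" "s < (2 - 2 * lam) / (1 + lam)"
  shows "hausdorff_measure s (S_s lam) \<noteq> 0"
proof -
  obtain \<tau> \<rho> where \<tau>: "(1 + lam) / (1 - lam) < \<tau>" "\<tau> * s < 2" and \<rho>: "(1 + \<tau>) * (1 + lam) < \<rho>"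
    "2 * \<tau> < \<rho>" "\<rho> * s < \<tau>" and s2: "s < 1 / 2" and \<tau>4: "4 < \<tau>"
    using tangent_exponents_exist[OF lam s] by blast
  have \<tau>1: "2 * lam + (\<tau> - 1) * (lam - 1) < 0"
    using \<tau>(1) lam by (simp add: pos_divide_less_eq algebra_simps)
  show ?thesis
  proof (rule positive_measure_near_reduced_fractions[where E = "deep_approx lam"
        and m = "\<lambda>V. nat \<lfloor>real V powr (\<tau> - 2)\<rfloor>" and l' = "\<lambda>V. real V powr (- \<rho>)"
        and g = "\<lambda>V. 1 / (4 * (real V powr (\<tau> - 1))\<^sup>2)" and t = "\<lambda>V. 4 * real V powr (- \<tau>)",
        OF s(1) _ _ _ _ deep_approx_subset_S_s])
    have "\<forall>\<^sub>F V::nat in sequentially. 0 < real V powr (- \<rho>)"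
      "\<forall>\<^sub>F V::nat in sequentially. 4 * real V powr (- \<tau>) + real V powr (- \<rho>) \<le> 1 / (2 * real V ^ 2)"
      "\<forall>\<^sub>F V::nat in sequentially. real V powr (- \<rho>) < 1 / (4 * (real V powr (\<tau> - 1))\<^sup>2)"
      "\<forall>\<^sub>F V::nat in sequentially. 1 \<le> real V powr (\<tau> - 2)"
      using \<rho> \<tau>4 by real_asymp+
    then show "\<forall>\<^sub>F V in sequentially. 0 < real V powr (- \<rho>) \<and> 0 \<le> 4 * real V powr (- \<tau>) \<and>
        4 * real V powr (- \<tau>) + real V powr (- \<rho>) \<le> 1 / (2 * real V ^ 2) \<and>
        real V powr (- \<rho>) < 1 / (4 * (real V powr (\<tau> - 1))\<^sup>2) \<and> 0 < nat \<lfloor>real V powr (\<tau> - 2)\<rfloor>"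
      by eventually_elim simp
  next
    fix K :: real assume "0 < K"
    then show "\<forall>\<^sub>F V in sequentially. \<forall>d. real V powr (- \<rho>) \<le> d \<and> d \<le> 1 / real V ^ 2 \<longrightarrow>
       K * min (real (nat \<lfloor>real V powr (\<tau> - 2)\<rfloor>)) (2 * d / (1 / (4 * (real V powr (\<tau> - 1))\<^sup>2)) + 1)
         \<le> real V ^ 2 * real (nat \<lfloor>real V powr (\<tau> - 2)\<rfloor>) * d powr s"
      using s s2 \<tau> \<tau>4 \<rho> by (intro tangent_scale) auto
  next
    fix n
    have "((\<lambda>V::nat. real V powr (2 * lam + (\<tau> - 1) * (lam - 1))) \<longlongrightarrow> 0) sequentially"
      using \<tau>1 by real_asymp
    moreover have "((\<lambda>V::nat. real V powr ((1 + \<tau>) * (1 + lam) - \<rho>)) \<longlongrightarrow> 0) sequentially"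
      using \<rho>(1) by real_asymp
    ultimately have "((\<lambda>V::nat. 4 * real V powr (2 * lam + (\<tau> - 1) * (lam - 1)) +
        3 * (2 powr (1 + lam) * real V powr ((1 + \<tau>) * (1 + lam) - \<rho>))) \<longlongrightarrow> 4 * 0 + 3 * (2 powr (1 + lam) * 0)) sequentially"
      by (intro tendsto_intros)
    then have "\<forall>\<^sub>F V::nat in sequentially. 4 * real V powr (2 * lam + (\<tau> - 1) * (lam - 1)) +
        3 * (2 powr (1 + lam) * real V powr ((1 + \<tau>) * (1 + lam) - \<rho>)) < 1"
      by (rule order_tendstoD) simp
    moreover have "\<forall>\<^sub>F V::nat in sequentially. 4 * n < V" by (rule eventually_gt_at_top)
    ultimately show "\<forall>\<^sub>F V in sequentially. \<forall>u v. coprime u v \<and> V < 4 * v \<and> v \<le> V \<and> u \<le> v \<longrightarrow>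
        (\<exists>B. finite B \<and> card B = nat \<lfloor>real V powr (\<tau> - 2)\<rfloor> \<and> B \<subseteq> {0..4 * real V powr (- \<tau>)} \<and>
          (\<forall>b\<in>B. \<forall>c\<in>B. b < c \<longrightarrow> 1 / (4 * (real V powr (\<tau> - 1))\<^sup>2) \<le> c - b) \<and>
          (\<forall>b\<in>B. {real u / real v + b .. real u / real v + b + real V powr (- \<rho>)} \<inter> {..1} \<subseteq> deep_approx lam n))"
    proof eventually_elim
      case (elim V)
      have "4 * (real V powr (2 * lam) * real V powr ((\<tau> - 1) * (lam - 1))) +
        3 * ((2 * real V powr (1 + \<tau>)) powr (1 + lam) * real V powr (- \<rho>)) < 1"
      proof -
        have "(2 * real V powr (1 + \<tau>)) powr (1 + lam) * real V powr (- \<rho>)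
            = 2 powr (1 + lam) * real V powr ((1 + \<tau>) * (1 + lam) - \<rho>)"
          by (simp add: powr_mult powr_powr powr_diff powr_minus divide_inverse)
        then show ?thesis using elim(1) by (simp only: powr_add)
      qed
      then show ?case
        using elim(2) lam \<tau>4 by (intro allI impI tangent_fractions_near) auto
    qed
  qed (use s2 in auto)
qed

section \<open>The upper bound\<close>

text \<open>
  The two divisibilities are read off from the equations of the plane, the second one modulo \<open>v\<close> and
  then the first one modulo \<open>v\<^sup>2\<close>. The vector \<open>(u, v) = (1, 0)\<close> is impossible because it forces \<open>p\<^sub>0 = 0\<close>.
\<close>

lemma special_divisibility:
  assumes "special (p0, p1, p2, p3)" "0 < p0"
  obtains u v :: int where "0 < v" "coprime u v" "v dvd p1" "v\<^sup>2 dvd p0"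
    "u\<^sup>2 * p0 - 2 * u * v * p1 + v\<^sup>2 * p2 = 0" "u\<^sup>2 * p1 - 2 * u * v * p2 + v\<^sup>2 * p3 = 0"
proof -
  obtain u v where uv: "coprime u v"
    and L: "(real_of_int p0, real_of_int p1, real_of_int p2, real_of_int p3) \<in> L_square u v"
    using assms(1) unfolding special_def by auto
  have "real_of_int (u\<^sup>2 * p0 - 2 * u * v * p1 + v\<^sup>2 * p2) = 0"
    "real_of_int (u\<^sup>2 * p1 - 2 * u * v * p2 + v\<^sup>2 * p3) = 0"
    using L by (simp_all add: L_square_def)
  then have e: "u\<^sup>2 * p0 - 2 * u * v * p1 + v\<^sup>2 * p2 = 0" "u\<^sup>2 * p1 - 2 * u * v * p2 + v\<^sup>2 * p3 = 0"
    by (simp_all only: of_int_eq_0_iff)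
  have "v \<noteq> 0"
  proof
    assume "v = 0"
    then have "u\<^sup>2 * p0 = 0" using e by simp
    then show False using uv \<open>v = 0\<close> assms(2) by auto
  qed
  \<comment> \<open>The subspace does not change when \<open>(u, v)\<close> changes sign.\<close>
  define u' v' where "u' = sgn v * u" and "v' = \<bar>v\<bar>"
  have v': "v' = sgn v * v" "0 < v'" using \<open>v \<noteq> 0\<close> by (simp_all add: v'_def sgn_if)
  have ss: "sgn v * sgn v = 1" using \<open>v \<noteq> 0\<close> by (simp add: sgn_if)
  have sq: "u'\<^sup>2 = u\<^sup>2" "v'\<^sup>2 = v\<^sup>2" "u' * v' = u * v"
    using ss by (simp_all add: u'_def v'(1) power_mult_distrib power2_eq_square mult.left_commute mult.assoc)
  have e': "u'\<^sup>2 * p0 - 2 * u' * v' * p1 + v'\<^sup>2 * p2 = 0" "u'\<^sup>2 * p1 - 2 * u' * v' * p2 + v'\<^sup>2 * p3 = 0"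
    using e sq by (simp_all add: mult.assoc)
  have uv': "coprime u' v'" using uv \<open>v \<noteq> 0\<close> by (auto simp: u'_def v'_def sgn_if)
  have c2: "coprime v' (u'\<^sup>2)" "coprime (v'\<^sup>2) (u'\<^sup>2)" using uv' by (simp_all add: coprime_commute)
  have "u'\<^sup>2 * p1 = v' * (2 * u' * p2 - v' * p3)" using e'(2) by (simp add: power2_eq_square algebra_simps)
  then have "v' dvd u'\<^sup>2 * p1" by simp
  then have d1: "v' dvd p1" using c2(1) by (simp add: coprime_dvd_mult_right_iff)
  then obtain w where w: "p1 = v' * w" by blast
  have "u'\<^sup>2 * p0 = v'\<^sup>2 * (2 * u' * w - p2)" using e'(1) by (simp add: w power2_eq_square algebra_simps)
  then have "v'\<^sup>2 dvd u'\<^sup>2 * p0" by simp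
  then have "v'\<^sup>2 dvd p0" using c2(2) by (simp add: coprime_dvd_mult_right_iff)
  then show ?thesis using that v'(2) uv' d1 e' by blast
qed

text \<open>
  The equation \<open>p1 * v = p0 * u\<close> says \<open>\<eta> = 0\<close>, so \<open>p\<close> is proportional to \<open>\<gamma>(u/v)\<close>, hence to
  \<open>(v\<^sup>3, v\<^sup>2 u, v u\<^sup>2, u\<^sup>3)\<close>.
\<close>

lemma cube_dvd_if_on_curve:
  fixes u v p0 p1 p2 p3 :: int
  assumes "coprime u v" "v \<noteq> 0" and on: "p1 * v = p0 * u"
    and e: "u\<^sup>2 * p0 - 2 * u * v * p1 + v\<^sup>2 * p2 = 0" "u\<^sup>2 * p1 - 2 * u * v * p2 + v\<^sup>2 * p3 = 0"
  shows "v ^ 3 dvd p0"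
proof -
  have "v * (v * (v * p2 - u * p1)) = v * 0" using on e(1) by algebra
  then have p2: "v * p2 = u * p1" using assms(2) by simp
  have "v * (v * (v * p3 - u * p2)) = v * 0" using p2 e(2) by algebra
  then have p3: "v * p3 = u * p2" using assms(2) by simp
  have "v ^ 3 * p3 = u ^ 3 * p0" using on p2 p3 by algebra
  then have "v ^ 3 dvd u ^ 3 * p0" by (metis dvd_triv_left)
  moreover have "coprime (v ^ 3) (u ^ 3)" using assms(1) by (simp add: coprime_commute)
  ultimately show ?thesis by (simp add: coprime_dvd_mult_right_iff)
qed

text \<open>
  The quadratic estimate for \<open>\<xi> - u/v\<close> always holds. The disjunction separates \<open>\<eta> = 0\<close> from
  \<open>\<eta> \<noteq> 0\<close>; in the latter case \<open>v/p\<^sub>0 \<le> \<bar>\<eta>\<bar>\<close> is compared with the quadratic estimate.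
\<close>

lemma special_approx_close:
  fixes \<xi> lam R :: real
  assumes lam: "0 \<le> lam" and R: "\<bar>\<xi>\<bar> \<le> R" and ap: "special_approx lam \<xi> (p0, p1, p2, p3)"
  obtains u v :: int where "0 < v" "coprime u v"
    "\<bar>\<xi> - of_int u / of_int v\<bar> \<le> (2 * R + 4) * real_of_int p0 powr (- (1 + lam) / 2)"
    "\<bar>\<xi> - of_int u / of_int v\<bar> < real_of_int v powr (- (3 * (1 + lam))) \<or>
     real_of_int v \<le> (2 * R + 5) * real_of_int p0 powr ((1 - lam) / 2)"
proof -
  define P where "P = real_of_int p0"
  have sp: "special (p0, p1, p2, p3)" and p0: "0 < p0" using ap by (auto simp: special_approx_def)
  have a1: "\<bar>P * \<xi> - p1\<bar> < P powr (- lam)" and a2: "\<bar>P * \<xi>\<^sup>2 - p2\<bar> < P powr (- lam)"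
    using ap by (auto simp: special_approx_def P_def)
  have P1: "1 \<le> P" using p0 by (simp add: P_def)
  obtain u v where v0: "0 < v" and uv: "coprime u v" and d: "v dvd p1" "v\<^sup>2 dvd p0"
    and e: "u\<^sup>2 * p0 - 2 * u * v * p1 + v\<^sup>2 * p2 = 0" "u\<^sup>2 * p1 - 2 * u * v * p2 + v\<^sup>2 * p3 = 0"
    using special_divisibility[OF sp p0] by blast
  define r where "r = real_of_int u / real_of_int v"
  define h where "h = \<bar>\<xi> - r\<bar>"
  define x where "x = P powr (- (1 + lam) / 2)"
  have R0: "0 \<le> R" using R by linarith
  have x0: "0 < x" "x \<le> 1"
    unfolding x_def using P1 lam powr_mono[of "- (1 + lam) / 2" 0 P] by auto
  have x2: "x\<^sup>2 = P powr (- (1 + lam))" using P1 by (simp add: x_def power2_eq_square flip: powr_add)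
  have Px2: "P powr (- lam) = P * x\<^sup>2"
  proof -
    have "P * P powr (- (1 + lam)) = P powr 1 * P powr (- (1 + lam))" using P1 by simp
    also have "\<dots> = P powr (- lam)" by (simp only: powr_add[symmetric]) simp
    finally show ?thesis by (simp add: x2)
  qed
  \<comment> \<open>Divided by \<open>v\<^sup>2\<close>, the first linear form defining the plane takes the value \<open>(\<xi> - r)\<^sup>2\<close> at
     \<open>\<gamma>(\<xi>)\<close>, and it vanishes at \<open>p\<close>.\<close>
  have er: "r\<^sup>2 * P - 2 * r * p1 + p2 = 0"
  proof -
    have "real_of_int (u\<^sup>2 * p0 - 2 * u * v * p1 + v\<^sup>2 * p2) = 0" using e(1) by simp
    then have "real_of_int v ^ 2 * (r\<^sup>2 * P - 2 * r * p1 + p2) = 0"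
      using v0 by (simp add: r_def P_def power_divide power2_eq_square algebra_simps)
    then show ?thesis using v0 by simp
  qed
  have "P * (\<xi> - r)\<^sup>2 = - 2 * r * (P * \<xi> - p1) + (P * \<xi>\<^sup>2 - p2)"
    using er by (simp add: power2_eq_square algebra_simps)
  also have "\<dots> \<le> \<bar>- 2 * r * (P * \<xi> - p1)\<bar> + \<bar>P * \<xi>\<^sup>2 - p2\<bar>" by linarith
  also have "\<dots> \<le> 2 * \<bar>r\<bar> * (P * x\<^sup>2) + P * x\<^sup>2"
    using a1 a2 by (intro add_mono) (auto simp: abs_mult Px2 intro!: mult_left_mono)
  also have "\<dots> = P * ((2 * \<bar>r\<bar> + 1) * x\<^sup>2)" by (simp add: algebra_simps)
  finally have "(\<xi> - r)\<^sup>2 \<le> (2 * \<bar>r\<bar> + 1) * x\<^sup>2" using P1 by simp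
  moreover have "\<bar>r\<bar> \<le> R + h" using R by (simp add: h_def)
  ultimately have h2: "h\<^sup>2 \<le> (2 * R + 1 + 2 * h) * x\<^sup>2"
    using mult_right_mono[of "2 * \<bar>r\<bar> + 1" "2 * R + 1 + 2 * h" "x\<^sup>2"] by (simp add: h_def)
  have hx: "h \<le> (2 * R + 4) * x"
  proof (rule ccontr)
    assume "\<not> h \<le> (2 * R + 4) * x"
    then have gt: "(2 * R + 4) * x < h" by simp
    define y where "y = h / x"
    have y: "h = y * x" "2 * R + 4 < y" using gt x0 by (auto simp: y_def pos_less_divide_eq)
    have "y\<^sup>2 * x\<^sup>2 \<le> (2 * R + 1 + 2 * (y * x)) * x\<^sup>2" using h2 by (simp add: y(1) power_mult_distrib)
    then have "y\<^sup>2 \<le> 2 * R + 1 + 2 * (y * x)" using x0 by simp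
    also have "\<dots> \<le> 2 * R + 1 + 2 * y" using x0 y R0 by (simp add: mult_left_le)
    finally have "y * (y - 2) \<le> 2 * R + 1" by (simp add: power2_eq_square algebra_simps)
    moreover have "1 * (2 * R + 2) \<le> y * (y - 2)" using y R0 by (intro mult_mono) auto
    ultimately show False by simp
  qed
  have near: "\<bar>\<xi> - p1 / P\<bar> < x\<^sup>2"
  proof -
    have "P * \<bar>\<xi> - p1 / P\<bar> = \<bar>P * \<xi> - p1\<bar>"
    proof -
      have "P * \<xi> - p1 = P * (\<xi> - p1 / P)" using P1 by (simp add: right_diff_distrib)
      then show ?thesis using P1 by (simp add: abs_mult)
    qed
    then have "P * \<bar>\<xi> - p1 / P\<bar> < P * x\<^sup>2" using a1 Px2 by simp
    then show ?thesis using P1 by simp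
  qed
  have "h < real_of_int v powr (- (3 * (1 + lam))) \<or> real_of_int v \<le> (2 * R + 5) * P powr ((1 - lam) / 2)"
  proof (cases "p1 * v = p0 * u")
    case True
    then have "v ^ 3 dvd p0" using cube_dvd_if_on_curve[OF uv _ True e] v0 by simp
    then have "v ^ 3 \<le> p0" using p0 by (rule zdvd_imp_le)
    then have vP: "real_of_int v ^ 3 \<le> P" by (simp add: P_def flip: of_int_power)
    have "p1 / P = r"
    proof -
      have "real_of_int p1 * v = P * u" using True by (simp add: P_def flip: of_int_mult)
      then show ?thesis using v0 P1 by (simp add: r_def field_simps)
    qed
    then have "h < P powr (- (1 + lam))" using near x2 by (simp add: h_def)
    also have "\<dots> \<le> (real_of_int v ^ 3) powr (- (1 + lam))"
      using vP v0 lam by (intro powr_mono2') auto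
    also have "\<dots> = real_of_int v powr (- (3 * (1 + lam)))"
      using v0 by (simp add: powr_powr flip: powr_numeral)
    finally show ?thesis ..
  next
    case False
    obtain a b where ab: "p1 = v * a" "p0 = v\<^sup>2 * b" using d by blast
    have "p1 * v - p0 * u = v\<^sup>2 * (a - b * u)" by (simp add: ab power2_eq_square algebra_simps)
    moreover have "1 \<le> \<bar>a - b * u\<bar>" using False calculation by (cases "a - b * u = 0") auto
    ultimately have "v\<^sup>2 * 1 \<le> \<bar>p1 * v - p0 * u\<bar>"
      by (simp only: abs_mult) (intro mult_mono, auto)
    then have "real_of_int (v\<^sup>2) \<le> real_of_int \<bar>p1 * v - p0 * u\<bar>" by (simp only: of_int_le_iff)
    then have vv: "real_of_int v ^ 2 \<le> \<bar>p1 * v - P * u\<bar>" by (simp add: P_def)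
    have "p1 / P - r = (p1 * v - P * u) / (P * v)"
      using v0 P1 by (simp add: r_def field_simps)
    then have "\<bar>p1 / P - r\<bar> = \<bar>p1 * v - P * u\<bar> / (P * v)" using v0 P1 by (simp add: abs_mult)
    also have "\<dots> \<ge> real_of_int v ^ 2 / (P * v)" using vv v0 P1 by (intro divide_right_mono) auto
    also have "real_of_int v ^ 2 / (P * v) = v / P" using v0 by (simp add: power2_eq_square)
    finally have "v / P \<le> \<bar>p1 / P - r\<bar>" .
    also have "\<dots> \<le> \<bar>\<xi> - p1 / P\<bar> + h" unfolding h_def by linarith
    also have "\<dots> \<le> x\<^sup>2 + (2 * R + 4) * x" using near hx by linarith
    also have "\<dots> \<le> x + (2 * R + 4) * x" using x0 by (simp add: power2_eq_square)
    finally have "v / P \<le> (2 * R + 5) * x" by (simp add: algebra_simps)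
    then have "v \<le> (2 * R + 5) * (x * P)" using P1 by (simp add: field_simps)
    also have "x * P = P powr ((1 - lam) / 2)"
    proof -
      have "x * P = P powr (- (1 + lam) / 2) * P powr 1" using P1 by (simp add: x_def)
      also have "\<dots> = P powr ((1 - lam) / 2)" by (simp only: powr_add[symmetric]) (simp add: field_simps)
      finally show ?thesis .
    qed
    finally show ?thesis by simp
  qed
  then show ?thesis using that[OF v0 uv] hx by (simp add: h_def r_def x_def P_def)
qed

lemma ball_gauge:
  fixes x r :: real
  assumes "0 < s" "0 \<le> r"
  shows "gauge_power s (cball x r) = ennreal ((2 * r) powr s)"
  using assms by (simp add: gauge_power_def diameter_cball)

lemma premeasure_finite_balls:
  fixes c :: "nat \<Rightarrow> real"
  assumes s: "0 < s" and r: "0 \<le> r" "2 * r \<le> \<delta>"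
  shows "hausdorff_premeasure s \<delta> (\<Union>j<N. cball (c j) r) \<le> ennreal (real N * (2 * r) powr s)"
proof -
  define A where "A = (\<lambda>j. if j < N then cball (c j) r else {})"
  have "(\<Union>j<N. cball (c j) r) = (\<Union>j. A j)" by (auto simp: A_def)
  then have "hausdorff_premeasure s \<delta> (\<Union>j<N. cball (c j) r) \<le> (\<Sum>j. hausdorff_premeasure s \<delta> (A j))"
    using premeasure_UN_le[of s \<delta> A] by simp
  also have "\<dots> \<le> (\<Sum>j. ennreal (if j < N then (2 * r) powr s else 0))"
  proof (intro suminf_le)
    show "hausdorff_premeasure s \<delta> (A j) \<le> ennreal (if j < N then (2 * r) powr s else 0)" for j
      using premeasure_le_gauge[of "cball (c j) r" \<delta> s] r s
      by (auto simp: A_def premeasure_empty ball_gauge diameter_cball)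
  qed auto
  also have "\<dots> = (\<Sum>j<N. ennreal (if j < N then (2 * r) powr s else 0))"
    by (rule suminf_finite) auto
  also have "\<dots> = ennreal (real N * (2 * r) powr s)"
    by (simp add: ennreal_mult ennreal_of_nat_eq_real_of_nat)
  finally show ?thesis .
qed

text \<open>
  For every \<open>n\<close> the set is covered by the intervals of radius \<open>C v powr (-\<tau>)\<close> around the \<open>O(v)\<close> admissible fractions
  with denominator \<open>v > n\<close>, and \<open>\<Sum> v * v powr (-\<tau> s)\<close> converges.
\<close>

lemma null_well_approximable:
  fixes C R \<tau> s :: real
  assumes s: "0 < s" "2 < \<tau> * s" and C: "0 < C"
    and A: "\<And>\<xi> n. \<xi> \<in> A \<Longrightarrow> \<exists>u v::int. int n < v \<and> \<bar>of_int u\<bar> \<le> R * of_int v \<and>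
      \<bar>\<xi> - of_int u / of_int v\<bar> \<le> C * of_int v powr (- \<tau>)"
  shows "hausdorff_measure s A = 0"
  unfolding hausdorff_measure_eq_0_iff
proof (intro allI impI)
  fix \<delta> :: real assume \<delta>: "0 < \<delta>"
  define K where "K = nat \<lceil>\<bar>R\<bar>\<rceil>"
  define N where "N = (\<lambda>v::nat. 2 * K * v + 1)"
  define r where "r = (\<lambda>v::nat. C * real v powr (- \<tau>))"
  define c where "c = (\<lambda>v j::nat. (real j - real (K * v)) / real v)"
  define G where "G = (\<lambda>v. \<Union>j<N v. cball (c v j) (r v))"
  have \<tau>: "0 < \<tau>" using s by (metis less_trans mult_less_0_iff not_less_iff_gr_or_eq zero_less_mult_iff zero_less_numeral)
  have cover: "A \<subseteq> (\<Union>v. G (v + Suc n))" for n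
  proof
    fix \<xi> assume "\<xi> \<in> A"
    then obtain u v :: int where uv: "int n < v" "\<bar>real_of_int u\<bar> \<le> R * of_int v"
      "\<bar>\<xi> - of_int u / of_int v\<bar> \<le> C * of_int v powr (- \<tau>)" using A by blast
    define w where "w = nat v"
    have w: "real_of_int v = real w" "n < w" "v = int w" using uv(1) by (auto simp: w_def)
    have "R \<le> real K" unfolding K_def by linarith
    then have "R * real w \<le> real K * real w" by (intro mult_right_mono) auto
    moreover have "\<bar>real_of_int u\<bar> \<le> R * real w" using uv(2) w(1) by simp
    ultimately have "\<bar>real_of_int u\<bar> \<le> real K * real w" by (rule order_trans[rotated])
    then have "real_of_int \<bar>u\<bar> \<le> real_of_int (int (K * w))" by simp
    then have u: "\<bar>u\<bar> \<le> int (K * w)" by (simp only: of_int_le_iff)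
    define j where "j = nat (u + int (K * w))"
    have j: "int j = u + int (K * w)" using u by (simp add: j_def)
    have "int j \<le> 2 * int (K * w)" using u j by linarith
    then have "j \<le> 2 * (K * w)" by linarith
    then have "j < N w" by (simp add: N_def mult.assoc)
    moreover have "c w j = u / real w"
    proof -
      have "real j = real_of_int (u + int (K * w))" using j by (metis of_int_of_nat_eq)
      then show ?thesis by (simp add: c_def)
    qed
    then have "\<xi> \<in> cball (c w j) (r w)" using uv(3) w by (simp add: r_def dist_real_def abs_minus_commute)
    ultimately have "\<xi> \<in> G w" by (auto simp: G_def)
    then show "\<xi> \<in> (\<Union>v. G (v + Suc n))" using w(2) by (intro UN_I[of "w - Suc n"]) auto
  qed
  define a where "a = (\<lambda>v. real (N v) * (2 * r v) powr s)"
  have a0: "0 \<le> a v" for v by (simp add: a_def)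
  have summ: "summable a"
  proof (rule summable_comparison_test_ev)
    have "\<forall>\<^sub>F v::nat in sequentially. 1 \<le> v" by (rule eventually_ge_at_top)
    then show "\<forall>\<^sub>F v in sequentially. norm (a v) \<le> ((2 * real K + 1) * (2 * C) powr s) * real v powr (1 - \<tau> * s)"
    proof eventually_elim
      case (elim v)
      have "(2 * r v) powr s = (2 * C) powr s * real v powr (- (\<tau> * s))"
        using C by (simp add: r_def powr_mult powr_powr)
      moreover have "real (N v) \<le> (2 * real K + 1) * real v" using elim by (simp add: N_def algebra_simps)
      ultimately have "a v \<le> ((2 * real K + 1) * real v) * ((2 * C) powr s * real v powr (- (\<tau> * s)))"
        unfolding a_def by (intro mult_mono) auto
      also have "\<dots> = ((2 * real K + 1) * (2 * C) powr s) * (real v powr 1 * real v powr (- (\<tau> * s)))"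
        using elim by simp
      also have "real v powr 1 * real v powr (- (\<tau> * s)) = real v powr (1 - \<tau> * s)"
        by (simp only: powr_add[symmetric]) simp
      finally show ?case using a0[of v] by simp
    qed
    show "summable (\<lambda>v. ((2 * real K + 1) * (2 * C) powr s) * real v powr (1 - \<tau> * s))"
      using s by (intro summable_mult) (simp add: summable_real_powr_iff)
  qed
  have small: "\<forall>\<^sub>F v in sequentially. 2 * r v \<le> \<delta>"
    unfolding r_def using C \<tau> \<delta> by real_asymp
  then obtain n0 where n0: "\<And>v. n0 \<le> v \<Longrightarrow> 2 * r v \<le> \<delta>" by (auto simp: eventually_sequentially)
  have bound: "hausdorff_premeasure s \<delta> A \<le> ennreal (\<Sum>v. a (v + Suc n))" if n: "n0 \<le> n" for n
  proof -
    have "hausdorff_premeasure s \<delta> A \<le> hausdorff_premeasure s \<delta> (\<Union>v. G (v + Suc n))"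
      by (rule premeasure_mono[OF cover])
    also have "\<dots> \<le> (\<Sum>v. hausdorff_premeasure s \<delta> (G (v + Suc n)))" by (rule premeasure_UN_le)
    also have "\<dots> \<le> (\<Sum>v. ennreal (a (v + Suc n)))"
    proof (intro suminf_le)
      show "hausdorff_premeasure s \<delta> (G (v + Suc n)) \<le> ennreal (a (v + Suc n))" for v
        unfolding G_def a_def
        using n C by (intro premeasure_finite_balls s n0) (auto simp: r_def)
    qed auto
    also have "\<dots> = ennreal (\<Sum>v. a (v + Suc n))"
      by (rule suminf_ennreal2[OF a0 summable_ignore_initial_segment[OF summ]])
    finally show ?thesis .
  qed
  have "(\<lambda>n. \<Sum>v. a (v + Suc n)) \<longlonglongrightarrow> 0"
    using LIMSEQ_Suc[OF suminf_exist_split2[OF summ]] .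
  then have lim: "(\<lambda>n. ennreal (\<Sum>v. a (v + Suc n))) \<longlonglongrightarrow> ennreal 0" by (rule tendsto_ennrealI)
  have "hausdorff_premeasure s \<delta> A \<le> ennreal 0"
  proof (rule tendsto_lowerbound[OF lim])
    show "\<forall>\<^sub>F n in sequentially. hausdorff_premeasure s \<delta> A \<le> ennreal (\<Sum>v. a (v + Suc n))"
      using eventually_ge_at_top[of n0] by eventually_elim (rule bound)
  qed simp
  then show "hausdorff_premeasure s \<delta> A = 0" by simp
qed

text \<open>
  Only finitely many denominators compete, and for each of them the best numerator is a
  rounding.
\<close>

lemma irrational_approx_denominator:
  fixes \<xi> :: real
  assumes "\<xi> \<notin> \<rat>"
  shows "\<exists>\<epsilon>>0. \<forall>u v::int. 0 < v \<and> v \<le> int n \<longrightarrow> \<epsilon> < \<bar>\<xi> - of_int u / of_int v\<bar>"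
proof -
  define S where "S = insert 1 ((\<lambda>v. \<bar>of_int v * \<xi> - of_int (round (of_int v * \<xi>))\<bar> / of_int v) ` {1..int n})"
  define \<epsilon> where "\<epsilon> = Min S / 2"
  have pos: "0 < \<bar>of_int v * \<xi> - of_int (round (of_int v * \<xi>))\<bar> / of_int v" if "v \<in> {1..int n}" for v
  proof -
    have "of_int v * \<xi> \<noteq> of_int (round (of_int v * \<xi>))"
    proof
      assume "of_int v * \<xi> = of_int (round (of_int v * \<xi>))"
      then have "\<xi> = of_int (round (of_int v * \<xi>)) / of_int v" using that by (simp add: field_simps)
      then show False using assms by (metis Rats_divide Rats_of_int)
    qed
    then show ?thesis using that by simp
  qed
  have "0 < \<epsilon>" unfolding \<epsilon>_def S_def using pos by auto
  moreover have "\<epsilon> < \<bar>\<xi> - of_int u / of_int v\<bar>" if "0 < v" "v \<le> int n" for u v :: int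
  proof -
    have v: "v \<in> {1..int n}" using that by simp
    have "Min S \<le> \<bar>of_int v * \<xi> - of_int (round (of_int v * \<xi>))\<bar> / of_int v"
      unfolding S_def using v by (intro Min_le) auto
    then have "2 * \<epsilon> \<le> \<bar>of_int v * \<xi> - of_int (round (of_int v * \<xi>))\<bar> / of_int v"
      by (simp add: \<epsilon>_def)
    also have "\<dots> \<le> \<bar>of_int v * \<xi> - of_int u\<bar> / of_int v"
      using that round_diff_minimal[of "of_int v * \<xi>" u]
      by (intro divide_right_mono) (auto simp: abs_minus_commute)
    also have "\<dots> = \<bar>\<xi> - of_int u / of_int v\<bar>"
    proof -
      have "of_int v * \<xi> - of_int u = of_int v * (\<xi> - of_int u / of_int v)" using that by (simp add: right_diff_distrib)
      then show ?thesis using that by (simp add: abs_mult)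
    qed
    finally show ?thesis using \<open>0 < \<epsilon>\<close> by linarith
  qed
  ultimately show ?thesis by blast
qed

text \<open>
  Irrationality makes the denominators \<open>v\<close> unbounded. This gives infinitely many approximations,
  and it rules out \<open>\<eta> \<noteq> 0\<close> when \<open>lam \<ge> 1\<close>, since then \<open>v\<close> would be at most \<open>2 R + 5\<close>.
\<close>

lemma S_s_approximations:
  fixes lam R \<tau> :: real
  assumes lam: "0 \<le> lam" and xi: "\<xi> \<in> S_s lam" "\<xi> \<notin> \<rat>" "\<bar>\<xi>\<bar> \<le> R"
    and \<tau>: "\<tau> \<le> 3 * (1 + lam)" "lam < 1 \<Longrightarrow> \<tau> \<le> (1 + lam) / (1 - lam)"
  defines "C \<equiv> (2 * R + 5) powr (1 + (1 + lam) / \<bar>1 - lam\<bar>)"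
  shows "\<exists>u v::int. int n < v \<and> \<bar>of_int u\<bar> \<le> (3 * R + 4) * of_int v \<and>
      \<bar>\<xi> - of_int u / of_int v\<bar> \<le> C * of_int v powr (- \<tau>)"
proof -
  define b where "b = 2 * R + 5"
  have b: "5 \<le> b" using xi(3) by (simp add: b_def)
  have Cb: "C = b * b powr ((1 + lam) / \<bar>1 - lam\<bar>)" using b unfolding C_def b_def[symmetric] by (simp add: powr_add)
  have C1: "1 \<le> C" unfolding C_def b_def[symmetric] using b lam by (intro ge_one_powr_ge_zero) auto
  define m where "m = max n (nat \<lceil>b\<rceil>)"
  obtain \<epsilon> where e: "0 < \<epsilon>" "\<And>u v::int. 0 < v \<Longrightarrow> v \<le> int m \<Longrightarrow> \<epsilon> < \<bar>\<xi> - of_int u / of_int v\<bar>"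
    using irrational_approx_denominator[OF xi(2), of m] by blast
  have "((\<lambda>k::nat. (2 * R + 4) * real k powr (- (1 + lam) / 2)) \<longlongrightarrow> (2 * R + 4) * 0) sequentially"
    by (intro tendsto_mult tendsto_const) (use lam in real_asymp)
  then have "\<forall>\<^sub>F k::nat in sequentially. (2 * R + 4) * real k powr (- (1 + lam) / 2) < \<epsilon>"
    using e(1) by (intro order_tendstoD(2)) auto
  then have "\<forall>\<^sub>F k::nat in sequentially. (2 * R + 4) * real k powr (- (1 + lam) / 2) < \<epsilon> \<and> 0 < k"
    by (intro eventually_conj eventually_gt_at_top)
  from eventually_happens'[OF sequentially_bot this]
  obtain k :: nat where k: "(2 * R + 4) * real k powr (- (1 + lam) / 2) < \<epsilon>" "0 < k" by blast
  obtain p0 p1 p2 p3 where ap: "special_approx lam \<xi> (p0, p1, p2, p3)" and p0: "int k \<le> p0"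
    using unbounded_if_mem_S_s[OF lam xi(1), of k] by (metis fst_conv surj_pair)
  define P where "P = real_of_int p0"
  have P: "real k \<le> P" "1 \<le> P" using p0 k(2) by (auto simp: P_def)
  obtain u v :: int where v0: "0 < v"
    and h1: "\<bar>\<xi> - of_int u / of_int v\<bar> \<le> (2 * R + 4) * P powr (- (1 + lam) / 2)"
    and h2: "\<bar>\<xi> - of_int u / of_int v\<bar> < real_of_int v powr (- (3 * (1 + lam))) \<or>
     real_of_int v \<le> b * P powr ((1 - lam) / 2)"
    using special_approx_close[OF lam xi(3) ap] unfolding P_def b_def by metis
  define h where "h = \<bar>\<xi> - of_int u / of_int v\<bar>"
  have R0: "0 \<le> R" using xi(3) by linarith
  have Pk: "P powr (- (1 + lam) / 2) \<le> real k powr (- (1 + lam) / 2)"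
    using P lam k(2) by (intro powr_mono2') auto
  have "(2 * R + 4) * P powr (- (1 + lam) / 2) \<le> (2 * R + 4) * real k powr (- (1 + lam) / 2)"
    using Pk R0 by (intro mult_left_mono) auto
  then have "h < \<epsilon>" using h1 k(1) unfolding h_def by linarith
  then have vm: "int m < v" using e(2)[OF v0, of u] unfolding h_def by (meson less_asym not_less)
  have v1: "1 \<le> real_of_int v" using v0 by simp
  have main: "h \<le> C * of_int v powr (- \<tau>)"
    using h2
  proof
    assume "\<bar>\<xi> - of_int u / of_int v\<bar> < real_of_int v powr (- (3 * (1 + lam)))"
    then have "h \<le> real_of_int v powr (- (3 * (1 + lam)))" by (simp add: h_def)
    also have "\<dots> \<le> real_of_int v powr (- \<tau>)" using \<tau>(1) v1 by (intro powr_mono) auto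
    also have "\<dots> \<le> C * real_of_int v powr (- \<tau>)" using C1 mult_right_mono[of 1 C "real_of_int v powr (- \<tau>)"] by simp
    finally show ?thesis .
  next
    assume vb: "real_of_int v \<le> b * P powr ((1 - lam) / 2)"
    have "lam < 1"
    proof (rule ccontr)
      assume "\<not> lam < 1"
      then have "P powr ((1 - lam) / 2) \<le> P powr 0" using P by (intro powr_mono) auto
      then have "P powr ((1 - lam) / 2) \<le> 1" using P by simp
      then have "b * P powr ((1 - lam) / 2) \<le> b" using b by (simp add: mult_left_le)
      then have "real_of_int v \<le> b" using vb by linarith
      moreover have "b \<le> real m" unfolding m_def by linarith
      ultimately show False using vm by linarith
    qed
    define \<kappa> where "\<kappa> = (1 + lam) / (1 - lam)"
    have \<kappa>: "0 < \<kappa>" "\<tau> \<le> \<kappa>" using lam \<open>lam < 1\<close> \<tau>(2) by (simp_all add: \<kappa>_def)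
    have \<kappa>C: "C = b * b powr \<kappa>" using \<open>lam < 1\<close> by (simp add: Cb \<kappa>_def)
    have "real_of_int v powr \<kappa> \<le> (b * P powr ((1 - lam) / 2)) powr \<kappa>"
      using vb v1 \<kappa> by (intro powr_mono2) auto
    also have "\<dots> = b powr \<kappa> * P powr ((1 - lam) / 2 * \<kappa>)"
      using b P by (simp add: powr_mult powr_powr)
    also have "(1 - lam) / 2 * \<kappa> = (1 + lam) / 2"
    proof -
      have "(1 - lam) * \<kappa> = 1 + lam" using \<open>lam < 1\<close> by (simp add: \<kappa>_def)
      then show ?thesis by simp
    qed
    finally have 1: "real_of_int v powr \<kappa> \<le> b powr \<kappa> * P powr ((1 + lam) / 2)" .
    have "P powr (- (1 + lam) / 2) \<le> b powr \<kappa> * real_of_int v powr (- \<kappa>)"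
    proof -
      have "P powr (- (1 + lam) / 2) = inverse (P powr ((1 + lam) / 2))"
      proof -
        have "- (1 + lam) / 2 = - ((1 + lam) / 2)" by (rule minus_divide_left[symmetric])
        then show ?thesis by (simp only: powr_minus)
      qed
      moreover have "real_of_int v powr (- \<kappa>) = inverse (real_of_int v powr \<kappa>)" by (rule powr_minus)
      moreover have "inverse y \<le> c * inverse z" if "z \<le> c * y" "0 < y" "0 < z" for y z c :: real
        using that by (simp add: field_simps)
      ultimately show ?thesis using 1 P v1 by simp
    qed
    then have "(2 * R + 4) * P powr (- (1 + lam) / 2) \<le> b * (b powr \<kappa> * real_of_int v powr (- \<kappa>))"
      using R0 b by (intro mult_mono) (auto simp: b_def)
    then have "h \<le> C * real_of_int v powr (- \<kappa>)" using h1 unfolding h_def \<kappa>C by (simp add: mult.assoc)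
    also have "\<dots> \<le> C * real_of_int v powr (- \<tau>)"
      using C1 \<kappa>(2) v1 by (intro mult_left_mono powr_mono) auto
    finally show ?thesis .
  qed
  have "\<bar>real_of_int u\<bar> \<le> (3 * R + 4) * of_int v"
  proof -
    have "P powr (- (1 + lam) / 2) \<le> P powr 0" using P lam by (intro powr_mono) auto
    then have "P powr (- (1 + lam) / 2) \<le> 1" using P by simp
    then have "(2 * R + 4) * P powr (- (1 + lam) / 2) \<le> 2 * R + 4" using R0 by (simp add: mult_left_le)
    then have "\<bar>of_int u / real_of_int v\<bar> \<le> 3 * R + 4" using h1 xi(3) by linarith
    then show ?thesis using v0 by (simp add: pos_divide_le_eq)
  qed
  moreover have "int n < v" using vm by (simp add: m_def)
  ultimately show ?thesis using main unfolding h_def by blast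
qed

lemma S_s_null:
  fixes lam s :: real
  assumes lam: "0 \<le> lam" and s: "max ((2 - 2 * lam) / (1 + lam)) (2 / (3 * (1 + lam))) < s"
  shows "hausdorff_measure s (S_s lam) = 0"
proof -
  have "0 < 2 / (3 * (1 + lam))" using lam by simp
  then have s0: "0 < s" using s unfolding max_less_iff_conj by (blast intro: less_trans)
  define \<tau> where "\<tau> = (if lam < 1 then min (3 * (1 + lam)) ((1 + lam) / (1 - lam)) else 3 * (1 + lam))"
  have "2 < 3 * (1 + lam) * s" using s lam by (simp add: pos_divide_less_eq mult_ac)
  moreover have "2 < (1 + lam) / (1 - lam) * s" if "lam < 1"
  proof -
    have "2 * (1 - lam) < (1 + lam) * s" using s lam by (simp add: pos_divide_less_eq mult_ac)
    then show ?thesis using that by (simp add: pos_less_divide_eq)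
  qed
  ultimately have \<tau>s: "2 < \<tau> * s" by (auto simp: \<tau>_def min_def)
  have null: "hausdorff_measure s {\<xi> \<in> S_s lam - \<rat>. \<bar>\<xi>\<bar> \<le> real R} = 0" for R :: nat
  proof (rule null_well_approximable[OF s0 \<tau>s])
    show "0 < (2 * real R + 5) powr (1 + (1 + lam) / \<bar>1 - lam\<bar>)" by (simp add: add_nonneg_pos)
  next
    fix \<xi> n assume xi: "\<xi> \<in> {\<xi> \<in> S_s lam - \<rat>. \<bar>\<xi>\<bar> \<le> real R}"
    show "\<exists>u v::int. int n < v \<and> \<bar>of_int u\<bar> \<le> (3 * real R + 4) * of_int v \<and>
      \<bar>\<xi> - of_int u / of_int v\<bar> \<le> (2 * real R + 5) powr (1 + (1 + lam) / \<bar>1 - lam\<bar>) * of_int v powr (- \<tau>)"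
      by (rule S_s_approximations[OF lam]) (use xi in \<open>auto simp: \<tau>_def\<close>)
  qed
  define A where "A = (\<lambda>R::nat. if R = 0 then \<rat> else {\<xi> \<in> S_s lam - \<rat>. \<bar>\<xi>\<bar> \<le> real R})"
  have "hausdorff_measure s (\<Union>R. A R) = 0"
  proof (rule null_UN)
    show "hausdorff_measure s (A R) = 0" for R
    proof -
      have "hausdorff_measure s (\<rat> :: real set) = 0" by (rule null_countable[OF countable_rat s0])
      then show ?thesis using null[of R] by (simp add: A_def)
    qed
  qed
  moreover have "S_s lam \<subseteq> (\<Union>R. A R)"
  proof
    fix \<xi> assume "\<xi> \<in> S_s lam"
    obtain R :: nat where "\<bar>\<xi>\<bar> \<le> real R" using real_arch_simple by blast
    then have "\<xi> \<in> A 0 \<or> \<xi> \<in> A (Suc R)" using \<open>\<xi> \<in> S_s lam\<close> by (auto simp: A_def)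
    then show "\<xi> \<in> (\<Union>R. A R)" by blast
  qed
  ultimately show ?thesis using null_mono by blast
qed

section \<open>The dimension\<close>

theorem theorem3:
  fixes lam :: real
  assumes "3 / 5 \<le> lam"
  shows "hausdorff_dim (S_s lam) =
    ereal (max ((2 - 2 * lam) / (1 + lam)) (2 / (3 * (1 + lam))))"
proof (rule hausdorff_dim_eqI)
  have lam: "0 \<le> lam" using assms by simp
  show "0 < max ((2 - 2 * lam) / (1 + lam)) (2 / (3 * (1 + lam)))" using lam by (simp add: less_max_iff_disj)
  show "hausdorff_measure s (S_s lam) = 0"
    if "max ((2 - 2 * lam) / (1 + lam)) (2 / (3 * (1 + lam))) < s" for s
    by (rule S_s_null[OF lam that])
  show "hausdorff_measure s (S_s lam) \<noteq> 0"
    if s: "0 < s" "s < max ((2 - 2 * lam) / (1 + lam)) (2 / (3 * (1 + lam)))" for s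
  proof (cases "s < 2 / (3 * (1 + lam))")
    case True
    then show ?thesis by (rule S_s_positive_measure_rational[OF lam s(1)])
  next
    case False
    then have s2: "s < (2 - 2 * lam) / (1 + lam)" using s(2) by simp
    then have "0 < (2 - 2 * lam) / (1 + lam)" using s(1) by linarith
    then have "lam < 1" using lam by (simp add: zero_less_divide_iff)
    then show ?thesis by (rule S_s_positive_measure_tangent[OF assms _ s(1) s2])
  qed
qed

end
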